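(* Let $A\in\mathbb{Z}$ and $B\in\mathbb{Z}_{\geqslant1}$, and let $\phi_{A,B}(z):=\operatorname{Li}_2(z)+4\pi^2A+2\pi iB\log z$. The equation $\phi_{A,B}(z)=0$ has a solution if and only if $-B/2<A\leqslant B/2$. For such $A,B$ the solution $z$ is unique and lies in the interior of the polar rectangle $$\mathcal{R}_{A,B}:=\{re^{i\theta}:\ r_1\leqslant r\leqslant r_2,\ \theta_1\leqslant\theta\leqslant\theta_2\},$$ where $\kappa:=\sum_{n\geqslant1}\sin(\pi n/3)/n^2$ and $r_1=1$, $r_2=\exp(\kappa/(\pi(2B-1)))$ if $-B/2<A<0$; $r_1=\exp(-\kappa/(2\pi B))$, $r_2=1$ if $0\leqslant A\leqslant B/2$; $\theta_1=\pi(2A-1/8)/B$ if $A\neq0$, $\theta_1=\pi/(24B)$ if $A=0$; $\theta_2=\pi(2A+1/8)/B$ if $A\neq B/2$, $\theta_2=\pi$ if $A=B/2$.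
   Context: $\log$ is the principal logarithm ($-\pi<\arg z\leqslant\pi$). $\operatorname{Li}_2$ is the principal dilogarithm: $\sum_{n\geqslant1}z^n/n^2$ for $|z|\leqslant1$, continued to $\mathbb{C}\setminus[1,\infty)$ by $-\int_0^z\log(1-u)\,du/u$, and on $[1,\infty)$ defined as the limit from the lower half plane. $\phi_{A,B}$ is considered on $\mathbb{C}\setminus\{0\}$. *)

theory Defs
  imports "HOL-Complex_Analysis.Complex_Analysis"
begin

(* The integral of -log(1-u)/u along the segment from 0 to z. The integrand has a removable
   singularity at u = 0; its junk value there (division by zero) does not affect the integral. *)
definition dilog_integral :: "complex \<Rightarrow> complex" where
  "dilog_integral z = contour_integral (linepath 0 z) (\<lambda>u. - (Ln (1 - u) / u))"

(* The series starts at n = 1, hence the shift. At z = 1, which lies both in the closed unit disc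
   and on the cut, the value is that of the series. In the last case z is real and > 1. *)
definition Li2 :: "complex \<Rightarrow> complex" where
  "Li2 z =
    (if norm z \<le> 1 then (\<Sum>n. z ^ Suc n / of_nat (Suc n) ^ 2)
     else if z \<notin> complex_of_real ` {1..} then dilog_integral z
     else Lim (at z within {w. Im w < 0}) dilog_integral)"

(* HOL defines Ln 0 = 0, so phi is meaningful only for z \<noteq> 0. *)
definition phi :: "int \<Rightarrow> int \<Rightarrow> complex \<Rightarrow> complex" where
  "phi A B z = Li2 z + 4 * of_real pi ^ 2 * of_int A + 2 * of_real pi * \<i> * of_int B * Ln z"

definition kappa :: real where
  "kappa = (\<Sum>n. sin (pi * real (Suc n) / 3) / real (Suc n) ^ 2)"

definition rad1 :: "int \<Rightarrow> int \<Rightarrow> real" where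
  "rad1 A B = (if A < 0 then 1 else exp (- kappa / (2 * pi * of_int B)))"

definition rad2 :: "int \<Rightarrow> int \<Rightarrow> real" where
  "rad2 A B = (if A < 0 then exp (kappa / (pi * (2 * of_int B - 1))) else 1)"

definition theta1 :: "int \<Rightarrow> int \<Rightarrow> real" where
  "theta1 A B = (if A \<noteq> 0 then pi * (2 * of_int A - 1/8) / of_int B else pi / (24 * of_int B))"

definition theta2 :: "int \<Rightarrow> int \<Rightarrow> real" where
  "theta2 A B =
    (if real_of_int A \<noteq> real_of_int B / 2 then pi * (2 * of_int A + 1/8) / of_int B else pi)"

definition polar_rect :: "int \<Rightarrow> int \<Rightarrow> complex set" where
  "polar_rect A B =
    {rcis r \<theta> | r \<theta>. rad1 A B \<le> r \<and> r \<le> rad2 A B \<and> theta1 A B \<le> \<theta> \<and> \<theta> \<le> theta2 A B}"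

end

(* Write z = exp (t + i th) with -pi < th <= pi. Then phi z = 0 says that w = t + i th is a fixed
   point of w |-> i (Li2 (exp w) + 4 pi^2 A) / (2 pi B), that is

     t = - Im (Li2 z) / (2 pi B)    and    th = (2 pi A + Re (Li2 z) / (2 pi)) / B.

   Since Im (Li2 z) has the sign of Im z, roots have t < 0 < th or th < 0 < t. As a function of w,
   Li2 (exp w) has derivative - Ln (1 - exp w), whose real part is - ln |1 - exp w| and whose
   imaginary part is less than pi in absolute value. Integrating it along rays and along the unit
   circle gives bounds on the real and imaginary parts of Li2 that are sharp enough to locate the
   roots, and to show that the fixed point map preserves a rectangle, so that Brouwer's theorem
   applies. Uniqueness holds because the derivative in w of phi (exp w) has imaginary part at least
   2 pi B - pi > 0, and a function on a convex set with this property is injective. *)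

theory Submission
  imports Defs "HOL-Real_Asymp.Real_Asymp"
begin

section \<open>The dilogarithm on the cut plane and on the unit disc\<close>

text \<open>Put rho = Re (Li2 z) / pi^2, so that th = pi (2 A + rho / 2) / B. In the closed disc
  |rho| <= 1/6, and outside it, at the radii that can occur, |rho| < 1/4. Hence th stays within pi /
  (8 B) of 2 pi A / B, which is the 1/8 in the rectangle, and integrality of A and B nearly decides
  the range of A. Only A = 0 and 2 A = B or - B need the sign of Re Li2. Near 1 it is positive, as
  \<open>Li2 1\<close> is pi^2/6; this pushes th above 0, so the root for A = 0 lies inside the
  disc. Near -1 it is negative, which pushes th below pi for 2 A = B (admissible) but below - pi for
  2 A = - B (outside the principal strip). This is the asymmetry of - B/2 < A <= B/2. The obstacle
  is the cut: \<open>Li2\<close> jumps there, and the point 1 is its tip. Roots on the cut need a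
  separate limit argument, and at 1 itself only continuity from the closed disc is
  available.\<close>

definition cut_plane :: "complex set" where
  "cut_plane = - (complex_of_real ` {1..})"

lemma mem_cut_plane: "z \<in> cut_plane \<longleftrightarrow> Im z \<noteq> 0 \<or> Re z < 1"
  by (auto simp: cut_plane_def image_iff complex_eq_iff not_less)

lemma one_minus_notin_nonpos_Reals: "z \<in> cut_plane \<Longrightarrow> 1 - z \<notin> \<real>\<^sub>\<le>\<^sub>0"
  by (auto simp: mem_cut_plane complex_nonpos_Reals_iff)

lemma open_cut_plane: "open cut_plane"
  unfolding cut_plane_def by (intro open_Compl closed_injective_linear_image)
     (auto simp: linear_iff inj_on_def scaleR_conv_of_real)

lemma segment_in_cut_plane:
  assumes "z \<in> cut_plane" "0 \<le> s" "s \<le> 1"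
  shows "of_real s * z \<in> cut_plane"
proof (cases "s = 0") 
  case False
  moreover have "s * Re z < 1" if "Re z < 1"
    using that assms mult_strict_left_mono[of "Re z" 1 s] \<open>s \<noteq> 0\<close> by linarith
  ultimately show ?thesis using assms by (auto simp: mem_cut_plane)
qed (auto simp: mem_cut_plane)

lemma starlike_cut_plane: "starlike cut_plane"
  unfolding starlike_def
proof (intro bexI[of _ 0] ballI subsetI)
  fix z x assume "z \<in> cut_plane" "x \<in> closed_segment 0 z"
  thus "x \<in> cut_plane" 
    using segment_in_cut_plane by (auto simp: in_segment scaleR_conv_of_real)
qed (auto simp: mem_cut_plane)

definition dilog_integrand :: "complex \<Rightarrow> complex" where
  "dilog_integrand u = (if u = 0 then 1 else - (Ln (1 - u) / u))"

lemma holomorphic_dilog_integrand: "dilog_integrand holomorphic_on cut_plane"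
proof (rule pole_theorem_open_0[where g = "\<lambda>u. - Ln (1 - u)" and a = 0])
  show "(\<lambda>u. - Ln (1 - u)) holomorphic_on cut_plane"
    by (intro holomorphic_intros one_minus_notin_nonpos_Reals)
  have "((\<lambda>u. - Ln (1 - u)) has_field_derivative 1) (at 0)"
    by (auto intro!: derivative_eq_intros)
  thus "dilog_integrand 0 = deriv (\<lambda>u. - Ln (1 - u)) 0"
    by (simp add: DERIV_imp_deriv dilog_integrand_def)
qed (auto simp: open_cut_plane dilog_integrand_def)

text \<open>On the starlike domain \<open>cut_plane\<close> the integrand has a primitive
  \<open>P\<close>, and integration along the segment from 0 yields
  \<open>P x - P 0\<close>.\<close>

lemma has_field_derivative_dilog_integral:
  assumes "z \<in> cut_plane"
  shows "(dilog_integral has_field_derivative dilog_integrand z) (at z)"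
proof -
  have "\<exists>P. \<forall>x\<in>cut_plane. (P has_field_derivative dilog_integrand x) (at x)"
    by (rule holomorphic_starlike_primitive[where k = "{}"])
       (use holomorphic_dilog_integrand holomorphic_on_imp_differentiable_at[OF _ open_cut_plane] in
         \<open>auto simp: holomorphic_on_imp_continuous_on starlike_cut_plane open_cut_plane\<close>)
  then obtain P where P: "\<And>x. x \<in> cut_plane \<Longrightarrow> (P has_field_derivative dilog_integrand x) (at x)"
    by blast
  have eq: "dilog_integral x = P x - P 0" if x: "x \<in> cut_plane" for x
  proof (cases "x = 0")
    case True
    then show ?thesis by (simp add: dilog_integral_def)
  next
    case False
    have "(dilog_integrand has_contour_integral (P (pathfinish (linepath 0 x)) - P (pathstart (linepath 0 x))))
            (linepath 0 x)"
    proof (rule contour_integral_primitive[where S = cut_plane])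
      show "path_image (linepath 0 x) \<subseteq> cut_plane"
        using segment_in_cut_plane[OF x]
        by (auto simp: in_segment scaleR_conv_of_real simp del: linepath_0)
      show "valid_path (linepath 0 x)" by (rule valid_path_linepath)
    qed (use P in \<open>auto intro: has_field_derivative_at_within\<close>)
    hence "((\<lambda>s. dilog_integrand (linepath 0 x s) * (x - 0)) has_integral P x - P 0) {0..1}"
      by (simp only: has_contour_integral_linepath pathstart_linepath pathfinish_linepath)
    \<comment> \<open>At parameter 0 the integrand of \<open>dilog_integral\<close> is 0 by division
      by zero, while \<open>dilog_integrand\<close> is 1; one point does not change the
      integral.\<close>
    hence "((\<lambda>s. - (Ln (1 - linepath 0 x s) / linepath 0 x s) * (x - 0)) has_integral P x - P 0) {0..1}"
      by (rule has_integral_spike_finite[where S = "{0}", rotated -1])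
         (use False in \<open>auto simp: dilog_integrand_def linepath_def\<close>)
    hence "((\<lambda>u. - (Ln (1 - u) / u)) has_contour_integral (P x - P 0)) (linepath 0 x)"
      by (simp only: has_contour_integral_linepath)
    thus ?thesis
      by (simp add: dilog_integral_def contour_integral_unique)
  qed
  have "((\<lambda>x. P x - P 0) has_field_derivative dilog_integrand z) (at z)"
    using P[OF assms] by (auto intro!: derivative_eq_intros)
  thus ?thesis
    by (rule has_field_derivative_transform_within_open[OF _ open_cut_plane assms]) (simp add: eq)
qed

section \<open>The series on the closed unit disc\<close>

definition dilog_series :: "complex \<Rightarrow> complex" where
  "dilog_series z = (\<Sum>n. z ^ Suc n / of_nat (Suc n) ^ 2)"

lemma inverse_squares_Suc_sums: "(\<lambda>n. 1 / real (Suc n) ^ 2) sums (pi\<^sup>2 / 6)"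
  using inverse_squares_sums by (simp add: add.commute)

lemma norm_dilog_term_le:
  "norm z \<le> 1 \<Longrightarrow> norm (z ^ Suc n / complex_of_nat (Suc n) ^ 2) \<le> 1 / real (Suc n) ^ 2"
  unfolding norm_divide norm_power norm_of_nat
  by (intro divide_right_mono power_le_one) auto

lemma dilog_series_sums:
  assumes "norm z \<le> 1"
  shows "(\<lambda>n. z ^ Suc n / complex_of_nat (Suc n) ^ 2) sums dilog_series z"
  unfolding dilog_series_def
  by (intro summable_sums summable_comparison_test'[OF sums_summable[OF inverse_squares_Suc_sums]]
        norm_dilog_term_le assms)

lemma norm_dilog_series_le:
  assumes "norm z \<le> 1"
  shows "norm (dilog_series z) \<le> pi\<^sup>2 / 6"
  using norm_suminf_le[OF norm_dilog_term_le[OF assms] sums_summable[OF inverse_squares_Suc_sums]]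
        sums_unique[OF inverse_squares_Suc_sums] unfolding dilog_series_def by (simp only:)

text \<open>The majorant 1/n^2 works up to the boundary circle, including the point 1, which lies
  outside \<open>cut_plane\<close>.\<close>

lemma continuous_on_dilog_series: "continuous_on (cball 0 1) dilog_series"
proof (rule uniform_limit_theorem)
  show "uniform_limit (cball 0 1) (\<lambda>N z. \<Sum>n<N. z ^ Suc n / complex_of_nat (Suc n) ^ 2)
          dilog_series sequentially"
    unfolding dilog_series_def
    by (rule Weierstrass_m_test[OF norm_dilog_term_le])
       (use sums_summable[OF inverse_squares_Suc_sums] in auto)
  show "\<forall>\<^sub>F N in sequentially.
      continuous_on (cball 0 1) (\<lambda>z. \<Sum>n<N. z ^ Suc n / complex_of_nat (Suc n) ^ 2)"
    by (intro always_eventually allI continuous_intros) (auto simp del: of_nat_Suc)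
qed auto

lemma has_field_derivative_dilog_series:
  assumes "norm z < 1"
  shows "(dilog_series has_field_derivative dilog_integrand z) (at z)"
proof -
  \<comment> \<open>\<open>c 0\<close> is 0 by division by zero, so the power series can be indexed
    from 0 without changing its sum.\<close>
  define c where "c = (\<lambda>n. 1 / complex_of_nat n ^ 2)"
  have series: "dilog_series x = (\<Sum>n. c n * x ^ n)" if "norm x < 1" for x
  proof -
    have "(\<lambda>n. c (Suc n) * x ^ Suc n) sums dilog_series x"
      using dilog_series_sums[of x] that by (simp add: c_def)
    hence "(\<lambda>n. c n * x ^ n) sums (dilog_series x + c 0 * x ^ 0)"
      by (subst (asm) sums_Suc_iff) auto
    thus ?thesis by (simp add: c_def sums_iff)
  qed
  have "summable (\<lambda>n. c (Suc n) * 1 ^ Suc n)"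
    using sums_summable[OF dilog_series_sums[of 1]] by (simp add: c_def)
  hence "summable (\<lambda>n. c n * 1 ^ n)"
    by (subst (asm) summable_Suc_iff)
  hence "((\<lambda>x. \<Sum>n. c n * x ^ n) has_field_derivative (\<Sum>n. diffs c n * z ^ n)) (at z)"
    by (rule termdiffs_strong) (use assms in auto)
  also have "(\<Sum>n. diffs c n * z ^ n) = dilog_integrand z"
  proof (cases "z = 0")
    case True
    have "(\<Sum>n. diffs c n * 0 ^ n) = diffs c 0"
      by (rule powser_zero)
    thus ?thesis
      by (simp add: True dilog_integrand_def c_def diffs_def)
  next
    case False
    have "(\<lambda>n. - (z ^ n / of_nat n)) sums ln (1 - z)"
      using Ln_series'[of "-z"] assms by simp
    hence "(\<lambda>n. - (z ^ Suc n / of_nat (Suc n))) sums ln (1 - z)"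
      by (subst sums_Suc_iff) auto
    hence "(\<lambda>n. - (1 / z) * - (z ^ Suc n / of_nat (Suc n))) sums (- (1 / z) * ln (1 - z))"
      by (rule sums_mult)
    also have "(\<lambda>n. - (1 / z) * - (z ^ Suc n / of_nat (Suc n))) = (\<lambda>n. diffs c n * z ^ n)"
      using False by (auto simp: diffs_def c_def fun_eq_iff power2_eq_square simp del: of_nat_Suc)
    finally show ?thesis using False by (simp add: dilog_integrand_def sums_iff)
  qed
  finally show ?thesis
    by (rule has_field_derivative_transform_within_open[of _ _ _ "ball 0 1"])
       (use assms in \<open>auto simp: series\<close>)
qed

text \<open>Both functions have derivative \<open>dilog_integrand\<close> in the open disc and
  vanish at 0; continuity along the radius to \<open>z\<close> carries the equality to the
  boundary.\<close>

lemma dilog_series_eq_dilog_integral: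
  assumes "norm z \<le> 1" "z \<noteq> 1"
  shows "dilog_series z = dilog_integral z"
proof -
  have cut: "w \<in> cut_plane" if "norm w \<le> 1" "w \<noteq> 1" for w
    using that complex_Re_le_cmod[of w] by (auto simp: mem_cut_plane complex_eq_iff)
  have "\<exists>c. \<forall>w\<in>ball 0 1. dilog_series w - dilog_integral w = c"
  proof (rule has_field_derivative_zero_constant)
    fix w :: complex assume w: "w \<in> ball 0 1"
    hence "w \<in> cut_plane" by (intro cut) auto
    hence "((\<lambda>w. dilog_series w - dilog_integral w) has_field_derivative
            dilog_integrand w - dilog_integrand w) (at w)"
      using w by (intro derivative_intros has_field_derivative_dilog_series
                    has_field_derivative_dilog_integral) auto
    thus "((\<lambda>w. dilog_series w - dilog_integral w) has_field_derivative 0) (at w within ball 0 1)"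
      by (simp add: has_field_derivative_at_within)
  qed auto
  then obtain c where c: "\<And>w. norm w < 1 \<Longrightarrow> dilog_series w - dilog_integral w = c"
    by (auto simp: dist_norm)
  from c[of 0] have "c = 0" by (simp add: dilog_series_def dilog_integral_def)
  define u where "u = (\<lambda>n. of_real (1 - inverse (real (Suc n))) * z)"
  have u_lt: "norm (u n) < 1" for n
  proof -
    have "norm (u n) \<le> (1 - inverse (real (Suc n))) * 1"
      unfolding u_def norm_mult norm_of_real
      by (intro mult_mono) (use assms in \<open>auto simp: field_simps\<close>)
    also have "\<dots> < 1" by simp
    finally show ?thesis .
  qed
  have u: "u \<longlonglongrightarrow> z"
    using tendsto_mult[OF tendsto_of_real[OF LIMSEQ_inverse_real_of_nat_add_minus[of 1]] tendsto_const[of z]]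
    by (simp add: u_def)
  have "(\<lambda>n. dilog_series (u n)) \<longlonglongrightarrow> dilog_series z"
    by (rule continuous_on_tendsto_compose[OF continuous_on_dilog_series u])
       (use assms u_lt in \<open>auto simp: less_imp_le\<close>)
  moreover have "(\<lambda>n. dilog_integral (u n)) \<longlonglongrightarrow> dilog_integral z"
    using isCont_tendsto_compose[OF DERIV_isCont[OF has_field_derivative_dilog_integral[OF cut]] u] assms
    by blast
  moreover have "dilog_series (u n) = dilog_integral (u n)" for n
    using c[OF u_lt] \<open>c = 0\<close> by simp
  ultimately show ?thesis
    using LIMSEQ_unique by fastforce
qed

lemma Li2_eq_dilog_series: "norm z \<le> 1 \<Longrightarrow> Li2 z = dilog_series z"
  by (simp add: Li2_def dilog_series_def)

lemma Li2_eq_dilog_integral: "z \<in> cut_plane \<Longrightarrow> Li2 z = dilog_integral z"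
  using dilog_series_eq_dilog_integral[of z] Li2_eq_dilog_series[of z]
  by (cases "norm z \<le> 1") (auto simp: mem_cut_plane Li2_def image_iff complex_eq_iff)

lemma has_field_derivative_Li2:
  assumes "z \<in> cut_plane"
  shows "(Li2 has_field_derivative dilog_integrand z) (at z)"
  using has_field_derivative_dilog_integral[OF assms]
  by (rule has_field_derivative_transform_within_open[OF _ open_cut_plane assms])
     (simp add: Li2_eq_dilog_integral)

lemma continuous_on_Li2_cball: "continuous_on (cball 0 1) Li2"
  using continuous_on_dilog_series
  by (rule continuous_on_eq) (auto simp: Li2_eq_dilog_series)

lemma norm_Li2_le: "norm z \<le> 1 \<Longrightarrow> norm (Li2 z) \<le> pi\<^sup>2 / 6"
  using norm_dilog_series_le[of z] by (simp only: Li2_eq_dilog_series)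

lemma Li2_0: "Li2 0 = 0"
  by (simp add: Li2_def)

lemma Li2_1: "Li2 1 = of_real (pi\<^sup>2 / 6)"
proof -
  have "(\<lambda>n. complex_of_real (1 / real (Suc n) ^ 2)) sums of_real (pi\<^sup>2 / 6)"
    by (rule sums_of_real[OF inverse_squares_Suc_sums])
  moreover have "(\<lambda>n. complex_of_real (1 / real (Suc n) ^ 2)) sums Li2 1"
    using dilog_series_sums[of 1] by (simp add: Li2_eq_dilog_series)
  ultimately show ?thesis by (rule sums_unique2[symmetric])
qed

lemma Li2_cnj:
  assumes "norm z \<le> 1"
  shows "Li2 (cnj z) = cnj (Li2 z)"
proof -
  have "(\<lambda>n. cnj (z ^ Suc n / complex_of_nat (Suc n) ^ 2)) sums cnj (Li2 z)"
    using dilog_series_sums[OF assms] assms by (simp only: sums_cnj Li2_eq_dilog_series)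
  moreover have "(\<lambda>n. cnj (z ^ Suc n / complex_of_nat (Suc n) ^ 2)) sums Li2 (cnj z)"
    using dilog_series_sums[of "cnj z"] assms by (simp add: Li2_eq_dilog_series)
  ultimately show ?thesis by (rule sums_unique2[symmetric])
qed

text \<open>Up to sign this is the alternating series of 1/n^2, for which the partial sum 1 - 1/4 is
  a lower bound.\<close>

lemma Re_Li2_minus_1_le: "Re (Li2 (-1)) \<le> - 3 / 4"
proof -
  define a where "a = (\<lambda>n. 1 / real (Suc n) ^ 2)"
  have "a \<longlonglongrightarrow> 0" using sums_summable[OF inverse_squares_Suc_sums] 
    unfolding a_def by (rule summable_LIMSEQ_zero)
  hence "(\<Sum>i<2*1. (-1)^i * a i) \<le> (\<Sum>i. (-1)^i * a i)"
    by (rule summable_Leibniz') (auto simp: a_def intro!: divide_left_mono power_mono)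
  moreover have "(\<lambda>n. Re ((-1) ^ Suc n / complex_of_nat (Suc n) ^ 2)) sums Re (Li2 (-1))"
    using dilog_series_sums[of "-1"] by (intro sums_Re) (simp add: Li2_eq_dilog_series)
  hence "(\<lambda>n. - Re ((-1) ^ Suc n / complex_of_nat (Suc n) ^ 2)) sums - Re (Li2 (-1))"
    by (rule sums_minus)
  moreover have "- Re ((-1) ^ Suc n / complex_of_nat (Suc n) ^ 2) = (-1)^n * a n" for n
  proof -
    have "(-1) ^ Suc n / complex_of_nat (Suc n) ^ 2 = of_real (- ((-1)^n * a n))"
      by (simp add: a_def)
    thus ?thesis by (simp only: Re_complex_of_real)
  qed
  ultimately show ?thesis
    by (simp add: sums_iff a_def numeral_2_eq_2)
qed

section \<open>The dilogarithm in polar coordinates\<close>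

text \<open>Reduces to one real variable, so that monotonicity criteria apply. For
  \<open>Li2 (exp w)\<close>, \<open>d = 1\<close> is the radial and \<open>d = \<i>\<close> the
  angular direction.\<close>

lemma DERIV_along_line:
  assumes "(f has_field_derivative f') (at (c + of_real s * d))"
  shows DERIV_Re_along_line:
          "((\<lambda>s. Re (f (c + of_real s * d))) has_real_derivative Re (f' * d)) (at s)"
    and DERIV_Im_along_line:
          "((\<lambda>s. Im (f (c + of_real s * d))) has_real_derivative Im (f' * d)) (at s)"
proof -
  have "((\<lambda>s. c + of_real s * d) has_vector_derivative d) (at s)"
    by (auto intro!: derivative_eq_intros)
  from field_vector_diff_chain_at[OF this assms]
  have *: "((\<lambda>s. f (c + of_real s * d)) has_vector_derivative f' * d) (at s)"
    by (simp add: o_def mult.commute)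
  show "((\<lambda>s. Re (f (c + of_real s * d))) has_real_derivative Re (f' * d)) (at s)"
    using bounded_linear.has_vector_derivative[OF bounded_linear_Re *]
    by (simp add: has_real_derivative_iff_has_vector_derivative)
  show "((\<lambda>s. Im (f (c + of_real s * d))) has_real_derivative Im (f' * d)) (at s)"
    using bounded_linear.has_vector_derivative[OF bounded_linear_Im *]
    by (simp add: has_real_derivative_iff_has_vector_derivative)
qed

text \<open>Noshiro-Warschawski argument: if \<open>f a = f b\<close> and \<open>d = b - a\<close>,
  then f (a + s d) / d has equal values at s = 0 and s = 1, although its imaginary part has
  derivative Im f' > 0 in s.\<close>

lemma Im_pos_derivative_imp_inj_on:
  assumes "convex S" and f: "\<And>w. w \<in> S \<Longrightarrow> (f has_field_derivative f' w) (at w)"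
    and pos: "\<And>w. w \<in> S \<Longrightarrow> 0 < Im (f' w)"
  shows "inj_on f S"
proof (rule inj_onI, rule ccontr)
  fix a b assume ab: "a \<in> S" "b \<in> S" "f a = f b" "a \<noteq> b"
  define d where "d = b - a"
  have d: "d \<noteq> 0" using ab by (simp add: d_def)
  have seg: "a + of_real s * d \<in> S" if "0 \<le> s" "s \<le> 1" for s
    using convexD_alt[OF \<open>convex S\<close> ab(1,2) that]
    by (simp add: d_def scaleR_conv_of_real algebra_simps)
  have "Im (f (a + of_real 0 * d) / d) < Im (f (a + of_real 1 * d) / d)"
  proof (rule DERIV_pos_imp_increasing[of 0 1])
    fix s :: real assume "0 \<le> s" "s \<le> 1"
    note s = seg[OF this]
    have "((\<lambda>w. f w / d) has_field_derivative f' (a + of_real s * d) / d) (at (a + of_real s * d))"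
      by (intro DERIV_cdivide f s)
    from DERIV_Im_along_line[OF this]
    show "\<exists>y. ((\<lambda>s. Im (f (a + of_real s * d) / d)) has_real_derivative y) (at s) \<and> 0 < y"
      using d pos[OF s] by auto
  qed simp
  thus False using ab by (simp add: d_def)
qed

lemma has_field_derivative_Li2_exp:
  assumes "exp w \<in> cut_plane"
  shows "((\<lambda>w. Li2 (exp w)) has_field_derivative - Ln (1 - exp w)) (at w)"
  using DERIV_chain2[OF has_field_derivative_Li2[OF assms] DERIV_exp]
  by (simp add: dilog_integrand_def)

text \<open>The radial coordinate is logarithmic: t < 0 is the inside of the unit disc.\<close>

abbreviation Li2_polar :: "real \<Rightarrow> real \<Rightarrow> complex" where
  "Li2_polar t \<theta> \<equiv> Li2 (exp (Complex t \<theta>))"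

lemma norm_exp_Complex [simp]: "norm (exp (Complex t \<theta>)) = exp t"
  by (simp add: norm_exp_eq_Re)

lemma exp_Complex_in_cut_plane:
  assumes "t < 0 \<or> sin \<theta> \<noteq> 0 \<or> t \<le> 0 \<and> cos \<theta> \<noteq> 1"
  shows "exp (Complex t \<theta>) \<in> cut_plane"
proof (cases "sin \<theta> = 0")
  case True
  have "exp t * cos \<theta> < 1"
  proof (cases "t < 0")
    case True
    have "exp t * cos \<theta> \<le> exp t * 1" by (intro mult_left_mono) auto
    thus ?thesis using True by (smt (verit) exp_less_one_iff mult.right_neutral)
  next
    case False
    hence "t \<le> 0" "cos \<theta> < 1" using assms True by (auto simp: less_le)
    thus ?thesis using False by simp
  qed
  thus ?thesis by (simp add: mem_cut_plane Re_exp)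
qed (auto simp: mem_cut_plane Im_exp)

lemma DERIV_Li2_polar_radial:
  assumes "exp (Complex t \<theta>) \<in> cut_plane"
  shows DERIV_Re_Li2_polar_radial: "((\<lambda>t. Re (Li2_polar t \<theta>)) has_real_derivative
                  - ln (norm (1 - exp (Complex t \<theta>)))) (at t)"
    and DERIV_Im_Li2_polar_radial: "((\<lambda>t. Im (Li2_polar t \<theta>)) has_real_derivative
                  - Im (Ln (1 - exp (Complex t \<theta>)))) (at t)"
proof -
  have eq: "Complex 0 \<theta> + of_real t * 1 = Complex t \<theta>" for t
    by (simp add: complex_eq_iff)
  have "1 - exp (Complex t \<theta>) \<noteq> 0"
    using one_minus_notin_nonpos_Reals[OF assms] by auto
  thus "((\<lambda>t. Re (Li2_polar t \<theta>)) has_real_derivative - ln (norm (1 - exp (Complex t \<theta>)))) (at t)"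
    "((\<lambda>t. Im (Li2_polar t \<theta>)) has_real_derivative - Im (Ln (1 - exp (Complex t \<theta>)))) (at t)"
    using DERIV_along_line[of "\<lambda>w. Li2 (exp w)" _ "Complex 0 \<theta>" t 1, unfolded eq,
            OF has_field_derivative_Li2_exp[OF assms]] by simp_all
qed

lemma DERIV_Li2_polar_angular:
  assumes "exp (Complex t \<theta>) \<in> cut_plane"
  shows DERIV_Re_Li2_polar_angular: "((\<lambda>\<theta>. Re (Li2_polar t \<theta>)) has_real_derivative
                  Im (Ln (1 - exp (Complex t \<theta>)))) (at \<theta>)"
    and DERIV_Im_Li2_polar_angular: "((\<lambda>\<theta>. Im (Li2_polar t \<theta>)) has_real_derivative
                  - ln (norm (1 - exp (Complex t \<theta>)))) (at \<theta>)"
proof -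
  have eq: "Complex t 0 + of_real \<theta> * \<i> = Complex t \<theta>" for \<theta>
    by (simp add: complex_eq_iff)
  have "1 - exp (Complex t \<theta>) \<noteq> 0"
    using one_minus_notin_nonpos_Reals[OF assms] by auto
  thus "((\<lambda>\<theta>. Re (Li2_polar t \<theta>)) has_real_derivative Im (Ln (1 - exp (Complex t \<theta>)))) (at \<theta>)"
    "((\<lambda>\<theta>. Im (Li2_polar t \<theta>)) has_real_derivative - ln (norm (1 - exp (Complex t \<theta>)))) (at \<theta>)"
    using DERIV_along_line[of "\<lambda>w. Li2 (exp w)" _ "Complex t 0" \<theta> \<i>, unfolded eq,
            OF has_field_derivative_Li2_exp[OF assms]] by simp_all
qed

lemma continuous_on_Li2_exp:
  assumes "\<And>w. w \<in> S \<Longrightarrow> Re w \<le> 0"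
  shows "continuous_on S (\<lambda>w. Li2 (exp w))"
  by (rule continuous_on_compose2[OF continuous_on_Li2_cball])
     (use assms in \<open>auto intro!: continuous_intros simp: norm_exp_eq_Re\<close>)

lemma continuous_on_Li2_polar_angular: 
  "continuous_on S (\<lambda>\<theta>. Li2_polar 0 \<theta>)"
  by (rule continuous_on_compose2[OF continuous_on_Li2_exp[of "{w. Re w \<le> 0}"]])
     (auto simp: Complex_eq intro!: continuous_intros)

lemma continuous_on_Li2_polar_radial:
  assumes "sin \<theta> \<noteq> 0 \<or> t2 \<le> 0"
  shows "continuous_on {t1..t2} (\<lambda>t. Li2_polar t \<theta>)"
proof (cases "sin \<theta> = 0")
  case True
  show ?thesis
    by (rule continuous_on_compose2[OF continuous_on_Li2_exp[of "{w. Re w \<le> 0}"]])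
       (use True assms in \<open>auto simp: Complex_eq intro!: continuous_intros\<close>)
next
  case False
  have "isCont (\<lambda>t. Li2_polar t \<theta>) t" for t
    by (rule isCont_o2[where g = "\<lambda>w. Li2 (exp w)"])
       (use DERIV_isCont[OF has_field_derivative_Li2_exp[of "Complex t \<theta>"]]
          exp_Complex_in_cut_plane[of t \<theta>] False in \<open>auto simp: Complex_eq intro!: continuous_intros\<close>)
  thus ?thesis by (intro continuous_at_imp_continuous_on) auto
qed

text \<open>Mean value theorem for s |-> Im (Li2 (s z)) on [0, 1]: the factor z cancels against the
  denominator of the integrand. What remains is the argument of 1 - s z, whose sign is opposite to
  that of Im z; this settles the sign of \<open>Im (Li2 z)\<close>, also outside the disc.\<close>

lemma Im_Li2_mvt:
  assumes "z \<in> cut_plane"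
  obtains s where "0 < s" "s < 1" "Im (Li2 z) = - Im (Ln (1 - of_real s * z)) / s"
proof (cases "z = 0")
  case True
  thus ?thesis using that[of "1/2"] by (simp add: Li2_0)
next
  case False
  have der: "((\<lambda>s. Im (Li2 (0 + of_real s * z))) has_real_derivative
           Im (dilog_integrand (0 + of_real s * z) * z)) (at s)" if "0 \<le> s" "s \<le> 1" for s
    by (rule DERIV_Im_along_line)
       (use segment_in_cut_plane[OF assms that] in \<open>simp add: has_field_derivative_Li2\<close>)
  obtain s where s: "0 < s" "s < 1" 
    "Im (Li2 (0 + of_real 1 * z)) - Im (Li2 (0 + of_real 0 * z)) = 
      (1 - 0) * Im (dilog_integrand (0 + of_real s * z) * z)"
    using MVT2[OF zero_less_one der] by blast
  moreover have "dilog_integrand (of_real s * z) * z = - Ln (1 - of_real s * z) / of_real s"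
    using False s by (simp add: dilog_integrand_def)
  ultimately show ?thesis using that[of s] by (simp add: Li2_0)
qed

lemma Im_Ln_neg:
  assumes "Im z < 0"
  shows "- pi < Im (Ln z)" "Im (Ln z) < 0"
proof -
  have "z \<noteq> 0" using assms by auto
  thus "- pi < Im (Ln z)" "Im (Ln z) < 0"
    using Im_Ln_pos_le[of z] Im_Ln_le_pi[of z] mpi_less_Im_Ln[of z] assms by auto
qed

lemma Im_Ln_one_minus_neg: "0 < s \<Longrightarrow> 0 < Im z \<Longrightarrow> Im (Ln (1 - of_real s * z)) < 0"
  by (rule Im_Ln_neg) auto

lemma Im_Ln_one_minus_pos: "0 < s \<Longrightarrow> Im z < 0 \<Longrightarrow> 0 < Im (Ln (1 - of_real s * z))"
  using Im_Ln_pos_lt_imp[of "1 - of_real s * z"] by (auto simp: mult_pos_neg)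

lemma Im_Li2_pos: "0 < Im z \<Longrightarrow> 0 < Im (Li2 z)"
  by (rule Im_Li2_mvt[of z]) (auto simp: mem_cut_plane Im_Ln_one_minus_neg divide_neg_pos)

lemma Im_Li2_neg: "Im z < 0 \<Longrightarrow> Im (Li2 z) < 0"
  by (rule Im_Li2_mvt[of z]) (auto simp: mem_cut_plane Im_Ln_one_minus_pos)

lemma Im_Li2_real: 
  assumes "Im z = 0" "Re z \<le> 1"
  shows "Im (Li2 z) = 0"
proof (cases "Re z = 1")
  case True
  hence "z = 1" using assms by (simp add: complex_eq_iff)
  thus ?thesis by (simp only: Li2_1 Im_complex_of_real)
next
  case False
  hence z: "z \<in> cut_plane" using assms by (auto simp: mem_cut_plane)
  obtain s where s: "0 < s" "s < 1" "Im (Li2 z) = - Im (Ln (1 - of_real s * z)) / s"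
    by (rule Im_Li2_mvt[OF z])
  have "of_real s * z \<in> cut_plane" using segment_in_cut_plane[OF z] s by simp
  hence "Re (1 - of_real s * z) > 0" "Im (1 - of_real s * z) = 0" using assms by (auto simp: mem_cut_plane)
  hence "Im (Ln (1 - of_real s * z)) = 0"
    by (metis Im_Ln_eq_0 complex_is_Real_iff less_irrefl zero_complex.simps(1))
  thus ?thesis using s by simp
qed

text \<open>\<open>kappa\<close> is the Clausen function Cl_2 at pi/3, about 1.015. The bound 6/5 is
  what \<open>kappa_div_le\<close> turns into the radial ranges 1/5 and 2/5.\<close>

lemma kappa_eq: "kappa = Im (Li2_polar 0 (pi / 3))"
  and kappa_le: "kappa \<le> 6 / 5"
proof -
  have "(\<lambda>n. exp (Complex 0 (pi / 3)) ^ Suc n / complex_of_nat (Suc n) ^ 2) sums Li2_polar 0 (pi / 3)"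
    using dilog_series_sums[of "exp (Complex 0 (pi / 3))"] by (simp add: Li2_eq_dilog_series)
  from sums_Im[OF this]
  have "(\<lambda>n. Im (exp (Complex 0 (pi / 3)) ^ Suc n / complex_of_nat (Suc n) ^ 2)) sums Im (Li2_polar 0 (pi / 3))" .
  also have "(\<lambda>n. Im (exp (Complex 0 (pi / 3)) ^ Suc n / complex_of_nat (Suc n) ^ 2)) =
             (\<lambda>n. sin (pi * real (Suc n) / 3) / real (Suc n) ^ 2)"
  proof
    fix n
    have "exp (Complex 0 (pi / 3)) ^ Suc n = cis (pi * real (Suc n) / 3)"
      by (simp add: exp_eq_polar Complex.DeMoivre mult.commute del: power_Suc)
    hence "exp (Complex 0 (pi / 3)) ^ Suc n / complex_of_nat (Suc n) ^ 2 =
             cis (pi * real (Suc n) / 3) / of_real (real (Suc n) ^ 2)"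
      by simp
    thus "Im (exp (Complex 0 (pi / 3)) ^ Suc n / complex_of_nat (Suc n) ^ 2) =
          sin (pi * real (Suc n) / 3) / real (Suc n) ^ 2"
      by (simp only: Im_divide_of_real cis.sel)
  qed
  finally have sums: "(\<lambda>n. sin (pi * real (Suc n) / 3) / real (Suc n) ^ 2) sums Im (Li2_polar 0 (pi / 3))" .
  thus eq: "kappa = Im (Li2_polar 0 (pi / 3))"
    by (simp only: kappa_def sums_iff)
  \<comment> \<open>The terms (1 - sin) / n^2 are nonnegative with sum pi^2/6 - kappa, so the first
    five of them bound \<open>kappa\<close> from above.\<close>
  define d where "d = (\<lambda>n. 1 / real (Suc n) ^ 2 - sin (pi * real (Suc n) / 3) / real (Suc n) ^ 2)"
  have "d sums (pi\<^sup>2 / 6 - kappa)"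
    unfolding d_def eq by (intro sums_diff inverse_squares_Suc_sums sums)
  moreover have "0 \<le> d n" for n
    unfolding d_def diff_divide_distrib[symmetric] by (intro divide_nonneg_nonneg) auto
  ultimately have "sum d {..<5} \<le> pi\<^sup>2 / 6 - kappa"
    using sum_le_suminf[of d "{..<5}"] by (simp add: sums_iff)
  moreover have "sin (pi * 2 / 3) = sqrt 3 / 2" "sin (pi * 4 / 3) = - sqrt 3 / 2"
     "sin (pi * 5 / 3) = - sqrt 3 / 2"
    using sin_120' sin_periodic_pi[of "pi / 3"] sin_periodic_pi[of "pi * 2 / 3"]
    by (simp_all add: sin_60 field_simps)
  hence "sum d {..<5} = 1 + 1/4 + 1/9 + 1/16 + 1/25 - sqrt 3 / 2 * (1 + 1/4 - 1/16 - 1/25)"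
    by (simp add: d_def eval_nat_numeral sin_60 algebra_simps)
  moreover have "sqrt 3 \<le> 7 / 4" by (rule real_le_lsqrt) (auto simp: power2_eq_square)
  moreover have "pi\<^sup>2 \<le> 3.15\<^sup>2" using pi_approx by (intro power_mono) auto
  ultimately show "kappa \<le> 6 / 5" by (simp add: power2_eq_square)
qed

lemma kappa_pos: "0 < kappa"
proof -
  have "0 < sin (pi / 3)" by (simp add: sin_60)
  thus ?thesis unfolding kappa_eq by (intro Im_Li2_pos) (simp add: Im_exp)
qed

section \<open>Bounds along rays and along the unit circle\<close>

lemma one_minus_exp_neq_0: "exp (Complex t \<theta>) \<in> cut_plane \<Longrightarrow> 0 < norm (1 - exp (Complex t \<theta>))"
  using one_minus_notin_nonpos_Reals by fastforce

lemma norm_one_minus_cis: "norm (1 - exp (Complex 0 \<theta>)) ^ 2 = 2 - 2 * cos \<theta>"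
  using sin_cos_squared_add[of \<theta>] unfolding cmod_power2
  by (simp add: Re_exp Im_exp power2_eq_square algebra_simps)

text \<open>The angular derivative is - ln |1 - exp (i x)|, and |1 - exp (i x)|^2 = 2 - 2 cos x
  passes 1 exactly at x = pi/3, so the maximum over the upper semicircle is there.\<close>

lemma Im_Li2_polar_0_le_kappa:
  assumes "0 \<le> \<theta>" "\<theta> \<le> pi"
  shows "Im (Li2_polar 0 \<theta>) \<le> kappa"
proof -
  have der: "((\<lambda>\<theta>. Im (Li2_polar 0 \<theta>)) has_real_derivative
               - ln (norm (1 - exp (Complex 0 x)))) (at x)"
    and pos: "0 < norm (1 - exp (Complex 0 x))"
    if "0 < x" "x < pi" for x
  proof -
    have cut: "exp (Complex 0 x) \<in> cut_plane"
      using that sin_gt_zero[of x] by (intro exp_Complex_in_cut_plane) auto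
    show "((\<lambda>\<theta>. Im (Li2_polar 0 \<theta>)) has_real_derivative
               - ln (norm (1 - exp (Complex 0 x)))) (at x)"
      by (rule DERIV_Im_Li2_polar_angular[OF cut])
    show "0 < norm (1 - exp (Complex 0 x))"
      by (rule one_minus_exp_neq_0[OF cut])
  qed
  have cont: "continuous_on S (\<lambda>\<theta>. Im (Li2_polar 0 \<theta>))" for S
    by (intro continuous_intros continuous_on_Li2_polar_angular)
  show ?thesis
  proof (cases "\<theta> \<le> pi / 3")
    case True
    show ?thesis unfolding kappa_eq
    proof (rule DERIV_nonneg_imp_increasing_open[OF True])
      fix x assume x: "\<theta> < x" "x < pi / 3"
      have "cos (pi / 3) \<le> cos x"
        by (rule cos_monotone_0_pi_le) (use x assms in auto)
      hence "norm (1 - exp (Complex 0 x)) ^ 2 \<le> 1\<^sup>2"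
        by (simp add: norm_one_minus_cis cos_60)
      hence "norm (1 - exp (Complex 0 x)) \<le> 1"
        by (rule power2_le_imp_le) simp
      thus "\<exists>y. ((\<lambda>\<theta>. Im (Li2_polar 0 \<theta>)) has_real_derivative y) (at x) \<and> 0 \<le> y"
        using der[of x] pos[of x] x assms
        by (intro exI[of _ "- ln (norm (1 - exp (Complex 0 x)))"]) auto
    qed (rule cont)
  next
    case False
    hence le: "pi / 3 \<le> \<theta>" by simp
    show ?thesis unfolding kappa_eq
    proof (rule DERIV_nonpos_imp_decreasing_open[OF le])
      fix x assume x: "pi / 3 < x" "x < \<theta>"
      hence x': "0 < x" using pi_gt_zero by (smt (verit) divide_pos_pos)
      have "cos x \<le> cos (pi / 3)"
        by (rule cos_monotone_0_pi_le) (use x assms in auto)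
      hence "1\<^sup>2 \<le> norm (1 - exp (Complex 0 x)) ^ 2"
        by (simp add: norm_one_minus_cis cos_60)
      hence "1 \<le> norm (1 - exp (Complex 0 x))"
        by (rule power2_le_imp_le) simp
      thus "\<exists>y. ((\<lambda>\<theta>. Im (Li2_polar 0 \<theta>)) has_real_derivative y) (at x) \<and> y \<le> 0"
        using der[of x] x' x assms
        by (intro exI[of _ "- ln (norm (1 - exp (Complex 0 x)))"]) auto
    qed (rule cont)
  qed
qed

text \<open>In the upper half plane arg (1 - z) < 0, so \<open>Im (Li2 z)\<close> increases strictly
  along rays up to its value on the circle.\<close>

lemma Im_Li2_polar_lt_kappa:
  assumes "0 < \<theta>" "\<theta> < pi" "t < 0"
  shows "Im (Li2_polar t \<theta>) < kappa"
proof -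
  have sin: "0 < sin \<theta>" using assms by (intro sin_gt_zero)
  have "Im (Li2_polar t \<theta>) < Im (Li2_polar 0 \<theta>)"
  proof (rule DERIV_pos_imp_increasing_open[OF \<open>t < 0\<close>])
    fix s
    have "Im (Ln (1 - exp (Complex s \<theta>))) < 0"
      using Im_Ln_one_minus_neg[of 1 "exp (Complex s \<theta>)"] sin by (simp add: Im_exp)
    thus "\<exists>y. ((\<lambda>t. Im (Li2_polar t \<theta>)) has_real_derivative y) (at s) \<and> 0 < y"
      using DERIV_Im_Li2_polar_radial[OF exp_Complex_in_cut_plane[of s \<theta>]] sin
      by (intro exI[of _ "- Im (Ln (1 - exp (Complex s \<theta>)))"]) auto
  qed (use sin in \<open>auto intro!: continuous_intros continuous_on_Li2_polar_radial\<close>)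
  also have "\<dots> \<le> kappa" using assms by (intro Im_Li2_polar_0_le_kappa) auto
  finally show ?thesis .
qed

text \<open>The real axis is included because the Brouwer box reaches angle 0 for A = 0 and angle pi
  for 2 A = B.\<close>

lemma Im_Li2_polar_nonneg_le_kappa:
  assumes "0 \<le> \<theta>" "\<theta> \<le> pi" "t \<le> 0"
  shows "0 \<le> Im (Li2_polar t \<theta>)" "Im (Li2_polar t \<theta>) \<le> kappa"
proof -
  have "0 \<le> Im (Li2_polar t \<theta>) \<and> Im (Li2_polar t \<theta>) \<le> kappa"
  proof (cases "\<theta> = 0 \<or> \<theta> = pi")
    case True
    hence "Im (exp (Complex t \<theta>)) = 0" "Re (exp (Complex t \<theta>)) \<le> 1"
      using assms complex_Re_le_cmod[of "exp (Complex t \<theta>)"] by (auto simp: Im_exp intro: order_trans)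
    thus ?thesis using kappa_pos by (simp add: Im_Li2_real)
  next
    case False
    hence "0 < sin \<theta>" using assms by (intro sin_gt_zero) auto
    thus ?thesis
      using Im_Li2_polar_lt_kappa[of \<theta> t] Im_Li2_polar_0_le_kappa[of \<theta>]
        Im_Li2_pos[of "exp (Complex t \<theta>)"] False assms
      by (cases "t = 0") (auto simp: Im_exp less_imp_le)
  qed
  thus "0 \<le> Im (Li2_polar t \<theta>)" "Im (Li2_polar t \<theta>) \<le> kappa" by auto
qed

lemma Li2_polar_uminus: "t \<le> 0 \<Longrightarrow> Li2_polar t (- \<theta>) = cnj (Li2_polar t \<theta>)"
  by (subst Li2_cnj[symmetric]) (auto simp: exp_cnj complex_cnj)

text \<open>The radial derivative of the imaginary part is an argument, hence at most \<^term>\<open>pi\<close> in absolute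
  value. This is where the factor $2B - 1$ in \<^const>\<open>rad2\<close> comes from.\<close>
lemma Im_Li2_polar_ge:
  assumes "- pi < \<theta>" "\<theta> < 0" "0 < t"
  shows "Im (Li2_polar 0 \<theta>) - pi * t < Im (Li2_polar t \<theta>)"
proof -
  have sin: "sin \<theta> < 0" using assms sin_gt_zero[of "-\<theta>"] by auto
  have "Im (Li2_polar 0 \<theta>) + pi * 0 < Im (Li2_polar t \<theta>) + pi * t"
  proof (rule DERIV_pos_imp_increasing_open[OF \<open>0 < t\<close>])
    fix s
    have "exp (Complex s \<theta>) \<in> cut_plane" using sin exp_Complex_in_cut_plane[of s \<theta>] by auto
    moreover from this have "Im (Ln (1 - exp (Complex s \<theta>))) < pi"
      by (intro Im_Ln_less_pi one_minus_notin_nonpos_Reals)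
    ultimately show "\<exists>y. ((\<lambda>t. Im (Li2_polar t \<theta>) + pi * t) has_real_derivative y) (at s) \<and> 0 < y"
      by (intro exI[of _ "- Im (Ln (1 - exp (Complex s \<theta>))) + pi * 1"] conjI DERIV_add
            DERIV_cmult DERIV_ident DERIV_Im_Li2_polar_radial) auto
  qed (use sin in \<open>auto intro!: continuous_intros continuous_on_Li2_polar_radial\<close>)
  thus ?thesis by simp
qed

corollary Im_Li2_polar_gt_kappa:
  assumes "- pi < \<theta>" "\<theta> < 0" "0 < t"
  shows "- kappa - pi * t < Im (Li2_polar t \<theta>)"
  using Im_Li2_polar_ge[OF assms] Im_Li2_polar_0_le_kappa[of "-\<theta>"] assms
  by (simp add: Li2_polar_uminus)

section \<open>The real part along the unit circle and along rays\<close>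

lemma Re_Li2_polar_0_diff_le:
  assumes "0 \<le> a" "a \<le> b" "b \<le> 2 * pi"
  shows "\<bar>Re (Li2_polar 0 b) - Re (Li2_polar 0 a)\<bar> \<le> pi / 2 * (b - a)"
proof -
  have der: "((\<lambda>\<theta>. Re (Li2_polar 0 \<theta>)) has_real_derivative
               Im (Ln (1 - exp (Complex 0 x)))) (at x)"
    and bd: "\<bar>Im (Ln (1 - exp (Complex 0 x)))\<bar> \<le> pi / 2"
    if "a < x" "x < b" for x
  proof -
    have "0 < sin (x / 2)"
      using that assms by (intro sin_gt_zero) auto
    hence "cos x \<noteq> 1"
      using cos_double_sin[of "x / 2"] by simp
    hence cut: "exp (Complex 0 x) \<in> cut_plane"
      using exp_Complex_in_cut_plane[of 0 x] by auto
    thus "((\<lambda>\<theta>. Re (Li2_polar 0 \<theta>)) has_real_derivative Im (Ln (1 - exp (Complex 0 x)))) (at x)"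
      by (rule DERIV_Re_Li2_polar_angular)
    \<comment> \<open>On the unit circle 1 - exp (i x) lies in the closed right half plane, so its
      argument is at most pi/2 in absolute value; this is the Lipschitz constant.\<close>
    have "1 - exp (Complex 0 x) \<noteq> 0" using one_minus_exp_neq_0[OF cut] by auto
    thus "\<bar>Im (Ln (1 - exp (Complex 0 x)))\<bar> \<le> pi / 2"
      by (subst Re_Ln_pos_le) (auto simp: Re_exp)
  qed
  have cont: "continuous_on S (\<lambda>\<theta>. Re (Li2_polar 0 \<theta>))" for S
    by (intro continuous_intros continuous_on_Li2_polar_angular)
  have "Re (Li2_polar 0 a) + pi / 2 * a \<le> Re (Li2_polar 0 b) + pi / 2 * b"
  proof (rule DERIV_nonneg_imp_increasing_open[OF assms(2)])
    fix x assume x: "a < x" "x < b"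
    show "\<exists>y. ((\<lambda>\<theta>. Re (Li2_polar 0 \<theta>) + pi / 2 * \<theta>) has_real_derivative y) (at x) \<and> 0 \<le> y"
      by (intro exI[of _ "Im (Ln (1 - exp (Complex 0 x))) + pi / 2 * 1"] conjI DERIV_add
            DERIV_cmult DERIV_ident der[OF x]) (use bd[OF x] in auto)
  qed (intro continuous_intros cont)
  moreover have "Re (Li2_polar 0 a) - pi / 2 * a \<ge> Re (Li2_polar 0 b) - pi / 2 * b"
  proof (rule DERIV_nonpos_imp_decreasing_open[OF assms(2)])
    fix x assume x: "a < x" "x < b"
    show "\<exists>y. ((\<lambda>\<theta>. Re (Li2_polar 0 \<theta>) - pi / 2 * \<theta>) has_real_derivative y) (at x) \<and> y \<le> 0"
      by (intro exI[of _ "Im (Ln (1 - exp (Complex 0 x))) - pi / 2 * 1"] conjI DERIV_diff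
            DERIV_cmult DERIV_ident der[OF x]) (use bd[OF x] in auto)
  qed (intro continuous_intros cont)
  moreover have "pi / 2 * (b - a) = pi / 2 * b - pi / 2 * a"
    by (rule right_diff_distrib)
  ultimately show ?thesis by linarith
qed

lemma Re_Li2_polar_0_ge:
  assumes "\<bar>\<theta>\<bar> \<le> pi"
  shows "Re (Li2_polar 0 \<theta>) \<ge> pi\<^sup>2 / 6 - pi / 2 * \<bar>\<theta>\<bar>"
proof -
  have "Re (Li2_polar 0 \<bar>\<theta>\<bar>) = Re (Li2_polar 0 \<theta>)"
    using Li2_polar_uminus[of 0 \<theta>] by (cases "\<theta> \<ge> 0") auto
  thus ?thesis
    using Re_Li2_polar_0_diff_le[of 0 "\<bar>\<theta>\<bar>"] assms Li2_1
    unfolding abs_le_iff by (simp flip: zero_complex.code)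
qed

text \<open>The Lipschitz bound anchored at -1; \<open>Re_Li2_polar_0_ge\<close> is its counterpart
  anchored at 1.\<close>

lemma Re_Li2_polar_0_le:
  assumes "\<bar>\<theta>\<bar> \<le> pi"
  shows "Re (Li2_polar 0 \<theta>) \<le> - 3 / 4 + pi / 2 * (pi - \<bar>\<theta>\<bar>)"
proof -
  have "Re (Li2_polar 0 \<bar>\<theta>\<bar>) = Re (Li2_polar 0 \<theta>)"
    using Li2_polar_uminus[of 0 \<theta>] by (cases "\<theta> \<ge> 0") auto
  moreover have "Re (Li2_polar 0 pi) = Re (Li2 (-1))"
    by (rule arg_cong[of _ _ "\<lambda>z. Re (Li2 z)"]) (simp add: complex_eq_iff Re_exp Im_exp)
  moreover have "\<bar>Re (Li2_polar 0 pi) - Re (Li2_polar 0 \<bar>\<theta>\<bar>)\<bar> \<le> pi / 2 * (pi - \<bar>\<theta>\<bar>)"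
    by (rule Re_Li2_polar_0_diff_le) (use assms in auto)
  ultimately show ?thesis
    using Re_Li2_minus_1_le by linarith
qed

text \<open>For t <= 2/5 the derivative of the real part is at least -1, because |1 - exp w| <= 1 +
  exp (2/5) <= e.\<close>

lemma Re_Li2_polar_radial_ge:
  assumes "t1 \<le> t2" "t2 \<le> 2 / 5" "sin \<theta> \<noteq> 0 \<or> t2 \<le> 0"
  shows "Re (Li2_polar t1 \<theta>) + t1 \<le> Re (Li2_polar t2 \<theta>) + t2"
proof (rule DERIV_nonneg_imp_increasing_open[OF assms(1)])
  fix t assume t: "t1 < t" "t < t2"
  have cut: "exp (Complex t \<theta>) \<in> cut_plane"
    using assms t by (intro exp_Complex_in_cut_plane) auto
  have "norm (1 - exp (Complex t \<theta>)) \<le> 1 + exp t"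
    using norm_triangle_ineq4[of 1 "exp (Complex t \<theta>)"] by simp
  also have "exp t \<le> exp (2 / 5)" using t assms by simp
  also have "1 + exp (2 / 5) \<le> exp (1::real)"
  proof -
    have "1 + exp (2 / 5) \<le> (1 + 1 / 2 + (1 / 2)\<^sup>2 / 2) ^ 2 + (0::real)"
      using exp_bound[of "2 / 5"] by (simp add: power2_eq_square)
    also have "\<dots> \<le> exp (1 / 2) ^ 2 + 0"
      using exp_lower_Taylor_quadratic[of "1 / 2"] by (intro add_mono power_mono) auto
    also have "\<dots> = exp 1" by (simp flip: exp_double)
    finally show ?thesis .
  qed
  finally have "ln (norm (1 - exp (Complex t \<theta>))) \<le> ln (exp 1)"
    using one_minus_exp_neq_0[OF cut] by (subst ln_le_cancel_iff) auto
  thus "\<exists>y. ((\<lambda>t. Re (Li2_polar t \<theta>) + t) has_real_derivative y) (at t) \<and> 0 \<le> y"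
    by (intro exI[of _ "- ln (norm (1 - exp (Complex t \<theta>))) + 1"] conjI DERIV_add DERIV_ident
          DERIV_Re_Li2_polar_radial[OF cut]) auto
qed (intro continuous_intros continuous_on_Li2_polar_radial assms)

lemma continuous_on_mult_ln: "continuous_on {0..T} (\<lambda>t::real. t * ln t)"
  unfolding continuous_on_eq_continuous_within
proof
  fix t :: real assume "t \<in> {0..T}"
  show "continuous (at t within {0..T}) (\<lambda>t. t * ln t)"
  proof (cases "t = 0")
    case True
    have "((\<lambda>t::real. t * ln t) \<longlongrightarrow> 0) (at_right 0)" by real_asymp
    hence "((\<lambda>t::real. t * ln t) \<longlongrightarrow> 0) (at 0 within {0..})"
      by (simp add: at_within_Ici_at_right)
    thus ?thesis unfolding continuous_within True
      by (auto intro: tendsto_within_subset)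
  next
    case False
    hence "((\<lambda>t. t * ln t) has_real_derivative ln t + 1) (at t)"
      using \<open>t \<in> {0..T}\<close> by (auto intro!: derivative_eq_intros)
    thus ?thesis by (rule continuous_at_imp_continuous_at_within[OF DERIV_isCont])
  qed
qed

text \<open>|1 - exp (s + i th)| >= exp s - 1 >= s, so the derivative is at most - ln s, which has
  primitive s - s ln s. This controls the logarithmic singularity at 1 uniformly in the
  angle.\<close>

lemma Re_Li2_polar_outward_le:
  assumes "0 \<le> t" "sin \<theta> \<noteq> 0"
  shows "Re (Li2_polar t \<theta>) \<le> Re (Li2_polar 0 \<theta>) + (t - t * ln t)"
proof -
  have "(0 - 0 * ln 0) - Re (Li2_polar 0 \<theta>) \<le> (t - t * ln t) - Re (Li2_polar t \<theta>)"
  proof (rule DERIV_nonneg_imp_increasing_open[OF assms(1)])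
    fix s assume s: "0 < s" "s < t"
    have cut: "exp (Complex s \<theta>) \<in> cut_plane"
      using assms by (intro exp_Complex_in_cut_plane) auto
    have "s \<le> exp s - 1" using exp_ge_add_one_self[of s] by linarith
    also have "\<dots> \<le> norm (1 - exp (Complex s \<theta>))"
      using norm_triangle_ineq2[of "exp (Complex s \<theta>)" 1] by (simp add: norm_minus_commute)
    finally have "ln s \<le> ln (norm (1 - exp (Complex s \<theta>)))"
      using s by (subst ln_le_cancel_iff) auto
    moreover have "((\<lambda>t. t - t * ln t) has_real_derivative - ln s) (at s)"
      using s by (auto intro!: derivative_eq_intros)
    ultimately show "\<exists>y. ((\<lambda>t. (t - t * ln t) - Re (Li2_polar t \<theta>)) has_real_derivative y) (at s) \<and> 0 \<le> y"
      by (intro exI[of _ "- ln s - - ln (norm (1 - exp (Complex s \<theta>)))"] conjI DERIV_diff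
            DERIV_Re_Li2_polar_radial[OF cut]) auto
  qed (use assms in \<open>auto intro!: continuous_intros continuous_on_Li2_polar_radial continuous_on_mult_ln\<close>)
  thus ?thesis by simp
qed

text \<open>For |z| = exp (- x) one has |1 - z| >= 1 - exp (- x) >= x exp (- x). The logarithm of
  this bound is ln x - x, and the extra x integrates to the quadratic term.\<close>

lemma Re_Li2_polar_inward_ge:
  assumes "0 \<le> s"
  shows "Re (Li2_polar (- s) \<theta>) \<ge> Re (Li2_polar 0 \<theta>) - (s - s * ln s + s\<^sup>2 / 2)"
proof -
  have "(0 - 0 * ln 0 + 0\<^sup>2 / 2) + Re (Li2_polar (- 0) \<theta>) \<le> (s - s * ln s + s\<^sup>2 / 2) + Re (Li2_polar (- s) \<theta>)"
  proof (rule DERIV_nonneg_imp_increasing_open[OF assms(1)])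
    fix x assume x: "0 < x" "x < s"
    have cut: "exp (Complex (- x) \<theta>) \<in> cut_plane"
      using x by (intro exp_Complex_in_cut_plane) auto
    have "x * exp (- x) \<le> (exp x - 1) * exp (- x)"
      using exp_ge_add_one_self[of x] by (intro mult_right_mono) (auto simp: le_diff_eq add.commute)
    also have "\<dots> = 1 - exp (- x)" by (simp add: algebra_simps exp_minus_inverse)
    also have "\<dots> \<le> norm (1 - exp (Complex (- x) \<theta>))"
      using norm_triangle_ineq2[of 1 "exp (Complex (- x) \<theta>)"] by simp
    finally have le: "x * exp (- x) \<le> norm (1 - exp (Complex (- x) \<theta>))" .
    have "0 < x * exp (- x)" using x by simp
    hence "ln (x * exp (- x)) \<le> ln (norm (1 - exp (Complex (- x) \<theta>)))"
      using le by (subst ln_le_cancel_iff) auto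
    hence le': "ln x - x \<le> ln (norm (1 - exp (Complex (- x) \<theta>)))"
      using x by (simp add: ln_mult)
    have d1: "((\<lambda>t. t - t * ln t + t\<^sup>2 / 2) has_real_derivative - ln x + x) (at x)"
      using x by (auto intro!: derivative_eq_intros)
    have d2: "((\<lambda>t. Re (Li2_polar (- t) \<theta>)) has_real_derivative
           - ln (norm (1 - exp (Complex (- x) \<theta>))) * - 1) (at x)"
      by (rule DERIV_chain2[where f = "\<lambda>t. Re (Li2_polar t \<theta>)" and g = uminus,
            OF DERIV_Re_Li2_polar_radial[OF cut]]) (auto intro!: derivative_eq_intros)
    show "\<exists>y. ((\<lambda>s. (s - s * ln s + s\<^sup>2 / 2) + Re (Li2_polar (- s) \<theta>)) has_real_derivative y) (at x) \<and> 0 \<le> y"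
      by (rule exI, rule conjI[OF DERIV_add[OF d1 d2]]) (use le' in simp)
  next
    have cont: "continuous_on {0..s} (\<lambda>x. Li2_polar (- x) \<theta>)"
      by (rule continuous_on_compose2[OF continuous_on_Li2_polar_radial[of \<theta> 0 "-s"]])
         (auto intro!: continuous_intros)
    show "continuous_on {0..s} (\<lambda>s. (s - s * ln s + s\<^sup>2 / 2) + Re (Li2_polar (- s) \<theta>))"
      by (rule continuous_on_add[OF _ continuous_on_Re[OF cont]])
         (auto intro!: continuous_on_add continuous_on_diff continuous_on_mult_ln
           continuous_on_power continuous_on_divide continuous_on_id continuous_on_const)
  qed 
  thus ?thesis by simp
qed

text \<open>In the left half plane Re (1 - z) >= 1, so ln |1 - z| >= 0. Serves to exclude 2 A = - B,
  whose candidate roots lie near the negative axis.\<close>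

lemma Re_Li2_polar_outward_antimono:
  assumes "0 \<le> t" "sin \<theta> \<noteq> 0" "cos \<theta> \<le> 0"
  shows "Re (Li2_polar t \<theta>) \<le> Re (Li2_polar 0 \<theta>)"
proof (rule DERIV_nonpos_imp_decreasing_open[OF assms(1)])
  fix s assume s: "0 < s" "s < t"
  have cut: "exp (Complex s \<theta>) \<in> cut_plane"
    using assms by (intro exp_Complex_in_cut_plane) auto
  have "1 \<le> Re (1 - exp (Complex s \<theta>))"
    using assms by (simp add: Re_exp mult_nonneg_nonpos)
  also have "\<dots> \<le> norm (1 - exp (Complex s \<theta>))" by (rule complex_Re_le_cmod)
  finally show "\<exists>y. ((\<lambda>t. Re (Li2_polar t \<theta>)) has_real_derivative y) (at s) \<and> y \<le> 0"
    using DERIV_Re_Li2_polar_radial[OF cut]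
    by (intro exI[of _ "- ln (norm (1 - exp (Complex s \<theta>)))"]) auto
qed (use assms in \<open>auto intro!: continuous_intros continuous_on_Li2_polar_radial\<close>)

text \<open>Passes \<open>Im_Li2_polar_ge\<close> to the limit from the lower half plane. It
  excludes roots on the cut, where the equation would give 2 pi B ln x <= pi ln x.\<close>

lemma Im_Li2_cut_ge:
  assumes "1 < x"
  shows "- pi * ln x \<le> Im (Li2 (complex_of_real x))"
proof -
  define H where "H = {w :: complex. Im w < 0}"
  define U where "U = ball (complex_of_real x) (x - 1)"
  have U: "1 < Re w" if "w \<in> U" for w
    using that abs_Re_le_cmod[of "of_real x - w"] by (simp add: U_def dist_norm)
  have xU: "of_real x \<in> U" and "open U" "convex U" using assms by (auto simp: U_def)
  text \<open>The continuation of the integrand from the lower half plane across the cut.\<close>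
  define h where "h = (\<lambda>w. - ((Ln (w - 1) + \<i> * of_real pi) / w))"
  have hol: "h holomorphic_on U"
  proof -
    have "w - 1 \<notin> \<real>\<^sub>\<le>\<^sub>0" "w \<noteq> 0" if "w \<in> U" for w
      using U[OF that] by (auto simp: complex_nonpos_Reals_iff)
    thus ?thesis unfolding h_def
      by (intro holomorphic_on_minus holomorphic_on_divide holomorphic_on_add holomorphic_on_Ln'
            holomorphic_on_diff holomorphic_on_ident holomorphic_on_const) auto
  qed
  have "\<exists>P. \<forall>w\<in>U. (P has_field_derivative h w) (at w within U)"
    by (rule holomorphic_convex_primitive'[OF \<open>convex U\<close> \<open>open U\<close> hol]) blast
  then obtain P where P: "\<And>w. w \<in> U \<Longrightarrow> (P has_field_derivative h w) (at w within U)"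
    by metis
  have P: "(P has_field_derivative h w) (at w)" if "w \<in> U" for w
    using P[OF that] unfolding at_within_open[OF that \<open>open U\<close>] .
  have "\<exists>c. \<forall>w\<in>U \<inter> H. dilog_integral w - P w = c"
  proof (rule has_field_derivative_zero_constant)
    show "convex (U \<inter> H)"
      unfolding H_def by (intro convex_Int \<open>convex U\<close> convex_halfspace_Im_lt)
    fix w assume w: "w \<in> U \<inter> H"
    hence "Ln (- (w - 1)) = Ln (w - 1) + \<i> * of_real pi" "w \<noteq> 0"
      using U[of w] Ln_minus[of "w - 1"] by (cases "w = 1"; auto simp: H_def)+
    hence "dilog_integrand w = h w"
      by (simp add: dilog_integrand_def h_def)
    moreover have "w \<in> cut_plane" using w by (simp add: H_def mem_cut_plane)
    ultimately have "((\<lambda>w. dilog_integral w - P w) has_field_derivative h w - h w) (at w)"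
      using w has_field_derivative_dilog_integral[of w] by (intro DERIV_diff P) auto
    thus "((\<lambda>w. dilog_integral w - P w) has_field_derivative 0) (at w within U \<inter> H)"
      by (simp add: has_field_derivative_at_within)
  qed
  then obtain c where c: "\<And>w. w \<in> U \<Longrightarrow> w \<in> H \<Longrightarrow> dilog_integral w - P w = c" by blast
  define F where "F = at (complex_of_real x) within H"
  have "F \<noteq> bot"
    unfolding F_def trivial_limit_within islimpt_approachable not_not
  proof (intro allI impI)
    fix e :: real assume "0 < e"
    thus "\<exists>y\<in>H. y \<noteq> complex_of_real x \<and> dist y (complex_of_real x) < e"
      by (intro bexI[of _ "of_real x - \<i> * of_real (e / 2)"])
         (auto simp: H_def dist_norm norm_mult complex_eq_iff)
  qed
  have "eventually (\<lambda>w. w \<in> U) (nhds (of_real x))"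
    using xU \<open>open U\<close> by (rule eventually_nhds_in_open[rotated])
  hence ev: "eventually (\<lambda>w. w \<in> U \<and> w \<in> H) F"
    by (auto simp: F_def eventually_at_filter elim: eventually_mono)
  have "((\<lambda>w. P w + c) \<longlongrightarrow> P (of_real x) + c) F"
    unfolding F_def
    by (intro tendsto_intros)
       (meson DERIV_isCont P continuous_at_imp_continuous_at_within continuous_within xU)
  \<comment> \<open>\<open>Lim\<close> is a definite description, so a limit must be exhibited
    before \<open>Li2\<close> has a known value on the cut; the primitive of the continued integrand
    supplies it.\<close>
  hence lim: "(dilog_integral \<longlongrightarrow> P (of_real x) + c) F"
    by (rule Lim_transform_eventually) (use ev c in \<open>auto elim!: eventually_mono simp: algebra_simps\<close>)
  hence Li2: "Li2 (of_real x) = P (of_real x) + c"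
    using assms tendsto_Lim[OF \<open>F \<noteq> bot\<close> lim] by (auto simp: Li2_def F_def H_def)
  \<comment> \<open>The lower bound of \<open>Im_Li2_polar_ge\<close> as a function of w:
    \<open>sgn w\<close> is the point of the unit circle on the same ray, and it tends to 1, where
    \<open>Im (Li2 1)\<close> is 0.\<close>
  have "isCont (\<lambda>w. Im (Li2 (sgn w)) - pi * ln (norm w)) (of_real x)"
  proof -
    have "continuous_on (- {0}) (\<lambda>w. Li2 (sgn w))"
      by (rule continuous_on_compose2[OF continuous_on_Li2_cball])
         (auto intro!: continuous_intros simp: norm_sgn split: if_splits)
    hence "isCont (\<lambda>w. Li2 (sgn w)) (of_real x)"
      using assms by (subst (asm) continuous_on_eq_continuous_at) auto
    thus ?thesis
      using assms by (intro continuous_intros) auto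
  qed
  hence "((\<lambda>w. Im (Li2 (sgn w)) - pi * ln (norm w)) \<longlongrightarrow>
          Im (Li2 (sgn (of_real x))) - pi * ln (norm (complex_of_real x))) F"
    unfolding F_def by (meson continuous_at_imp_continuous_at_within continuous_within)
  hence lim': "((\<lambda>w. Im (Li2 (sgn w)) - pi * ln (norm w)) \<longlongrightarrow> - pi * ln x) F"
    using assms by (simp add: sgn_of_real Im_Li2_real)
  have "- pi * ln x \<le> Im (P (of_real x) + c)"
  proof (rule tendsto_le[OF \<open>F \<noteq> bot\<close> tendsto_Im[OF lim] lim'])
    show "\<forall>\<^sub>F w in F. Im (Li2 (sgn w)) - pi * ln (norm w) \<le> Im (dilog_integral w)"
      using ev
    proof eventually_elim
      case (elim w)
      hence w: "w \<noteq> 0" "Im w < 0" "1 < norm w" "w \<in> cut_plane"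
        using U[of w] complex_Re_le_cmod[of w] by (auto simp: H_def mem_cut_plane)
      have exp: "exp (Complex (ln (norm w)) (Im (Ln w))) = w"
        using w by (metis Re_Ln complex_surj exp_Ln)
      have "exp (Complex 0 (Im (Ln w))) = sgn w"
        using w exp by (metis Arg_eq_Im_Ln cis_Arg cis_conv_exp Complex_eq_0 complex_of_real_i mult.commute)
      thus ?case
        using Im_Li2_polar_ge[of "Im (Ln w)" "ln (norm w)"] Im_Ln_neg[of w] w exp
        by (simp add: Li2_eq_dilog_integral)
    qed
  qed
  thus ?thesis by (simp only: Li2)
qed

section \<open>The roots\<close>

lemma phi_eq_0_iff:
  assumes "B \<ge> 1"
  shows "phi A B z = 0 \<longleftrightarrow>
           Re (Ln z) = - Im (Li2 z) / (2 * pi * of_int B) \<and>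
           Im (Ln z) = pi * (2 * of_int A + Re (Li2 z) / (2 * pi\<^sup>2)) / of_int B"
proof -
  define k where "k = 2 * pi * of_int B"
  have k: "0 < k" using assms by (simp add: k_def)
  have "phi A B z = Li2 z + of_real (4 * pi\<^sup>2 * of_int A) + of_real k * (\<i> * Ln z)"
    by (simp add: phi_def k_def algebra_simps)
  hence "Re (phi A B z) = Re (Li2 z) + 4 * pi\<^sup>2 * of_int A - k * Im (Ln z)"
        "Im (phi A B z) = Im (Li2 z) + k * Re (Ln z)"
    by (simp_all only: plus_complex.sel Re_complex_of_real Im_complex_of_real times_complex.sel) simp_all
  moreover have "pi * (2 * of_int A + Re (Li2 z) / (2 * pi\<^sup>2)) / of_int B =
                   (Re (Li2 z) + 4 * pi\<^sup>2 * of_int A) / k"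
    unfolding k_def by (simp add: divide_simps power2_eq_square)
  moreover have "x - k * y = 0 \<longleftrightarrow> y = x / k" "x + k * y = 0 \<longleftrightarrow> y = - x / k" for x y
    using k by (auto simp: field_simps)
  ultimately show ?thesis
    by (simp only: complex_eq_iff zero_complex.sel k_def[symmetric]) auto
qed

text \<open>Re (Ln z) has the sign opposite to that of \<open>Im (Li2 z)\<close>, hence to that of
  Im z; the work is to exclude real z.\<close>

lemma phi_root_location:
  assumes "B \<ge> 1" "z \<noteq> 0" "phi A B z = 0"
  shows "Re (Ln z) < 0 \<and> 0 < Im (Ln z) \<and> Im (Ln z) < pi \<or>
         0 < Re (Ln z) \<and> - pi < Im (Ln z) \<and> Im (Ln z) < 0"
proof -
  have t: "Re (Ln z) = - Im (Li2 z) / (2 * pi * of_int B)"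
    and \<theta>: "Im (Ln z) = pi * (2 * of_int A + Re (Li2 z) / (2 * pi\<^sup>2)) / of_int B"
    using assms by (auto simp: phi_eq_0_iff)
  have B: "1 \<le> real_of_int B" using assms by simp
  consider "0 < Im z" | "Im z < 0" | "Im z = 0" "1 < Re z" | "Im z = 0" "Re z \<le> 1"
    by linarith
  thus ?thesis
  proof cases
    case 1
    thus ?thesis using Im_Li2_pos[OF 1] Im_Ln_pos_lt_imp[OF 1] B by (simp add: t divide_neg_pos)
  next
    case 2
    thus ?thesis using Im_Li2_neg[OF 2] Im_Ln_neg[OF 2] B by (simp add: t divide_neg_pos)
  next
    case 3
    define x where "x = Re z"
    have x: "z = of_real x" "1 < x" using 3 by (auto simp: x_def complex_eq_iff)
    hence "ln x = - Im (Li2 z) / (2 * pi * of_int B)" using t by simp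
    hence "2 * pi * of_int B * ln x = - Im (Li2 z)" using B by (simp add: field_simps)
    also have "\<dots> \<le> pi * ln x" using Im_Li2_cut_ge[of x] x by simp
    finally have "2 * real_of_int B \<le> 1" using x by (simp add: mult.assoc)
    thus ?thesis using B by simp
  next
    case 4
    hence "ln (norm z) = 0" using t assms Im_Li2_real[of z] by simp
    hence "norm z = 1" using assms by simp
    hence "z = 1 \<or> z = -1" using 4 by (auto simp: cmod_def complex_eq_iff)
    thus ?thesis
    proof
      assume "z = 1"
      hence "2 * real_of_int A + 1 / 12 = 0" using \<theta> B by (simp add: Li2_1)
      hence "real_of_int (24 * A) = - 1" by simp
      hence "24 * A = - 1" by linarith
      thus ?thesis by presburger
    next
      assume z: "z = -1"
      \<comment> \<open>At -1 the angle equation reads 2 A - B = - rho / 2, which lies strictly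
        between 0 and 1.\<close>
      define \<rho> where "\<rho> = Re (Li2 z) / pi\<^sup>2"
      have "\<rho> < 0" unfolding \<rho>_def using z Re_Li2_minus_1_le by (intro divide_neg_pos) auto
      moreover have "- (1 / 6) \<le> \<rho>"
        using z norm_Li2_le[of z] abs_Re_le_cmod[of "Li2 z"] by (simp add: \<rho>_def field_simps)
      moreover have "x = b" if "pi = pi * x / b" "1 \<le> b" for x b :: real
        using that by (simp add: field_simps)
      hence "2 * real_of_int A + Re (Li2 z) / (2 * pi\<^sup>2) = of_int B"
        using \<theta> z B by simp
      hence "2 * real_of_int A + \<rho> / 2 = of_int B" by (simp add: \<rho>_def)
      ultimately have "real_of_int (2 * A - B) > 0" "real_of_int (2 * A - B) < 1" by simp_all
      hence "0 < 2 * A - B" "2 * A - B < 1" by (simp_all only: of_int_0_less_iff of_int_less_1_iff)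
      hence False by linarith
      thus ?thesis ..
    qed
  qed
qed

text \<open>Off the negative axis modulus and argument are continuous, so strict inequalities for
  them define an open set.\<close>

lemma in_interior_polar_rect:
  assumes "ln (rad1 A B) < Re (Ln z)" "Re (Ln z) < ln (rad2 A B)"
    and "theta1 A B < Im (Ln z)" "Im (Ln z) < theta2 A B" "Im (Ln z) < pi" "z \<noteq> 0"
  shows "z \<in> interior (polar_rect A B)"
proof (rule interiorI)
  let ?R = "{rad1 A B<..<rad2 A B} \<times> {theta1 A B<..<theta2 A B}"
  let ?T = "- \<real>\<^sub>\<le>\<^sub>0 \<inter> (\<lambda>w. (norm w, Im (Ln w))) -` ?R"
  show "open ?T"
    by (intro continuous_open_preimage continuous_intros open_Times) auto
  have rad: "0 < rad1 A B" "0 < rad2 A B" by (auto simp: rad1_def rad2_def)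
  have "z \<notin> \<real>\<^sub>\<le>\<^sub>0"
    using assms Im_Ln_eq_pi[of z] by (auto simp: complex_nonpos_Reals_iff complex_eq_iff less_le)
  thus "z \<in> ?T" using assms rad by simp
  show "?T \<subseteq> polar_rect A B"
  proof
    fix w assume w: "w \<in> ?T"
    hence "w \<noteq> 0" by auto
    hence "w = rcis (norm w) (Im (Ln w))"
      by (simp add: Arg_eq_Im_Ln[symmetric] rcis_cmod_Arg)
    thus "w \<in> polar_rect A B" using w unfolding polar_rect_def
      by (intro CollectI exI[of _ "norm w"] exI[of _ "Im (Ln w)"]) (auto simp: less_imp_le)
  qed
qed

section \<open>Numerical bounds on the real part\<close>

lemma pi_squared_bounds: "9.6 < pi\<^sup>2" "pi\<^sup>2 < 10"
proof -
  have "3.1\<^sup>2 < pi\<^sup>2" using pi_approx by (intro power_strict_mono) auto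
  thus "9.6 < pi\<^sup>2" by (simp add: power2_eq_square)
  have "pi\<^sup>2 < 3.15\<^sup>2" using pi_approx by (intro power_strict_mono) auto
  thus "pi\<^sup>2 < 10" by (simp add: power2_eq_square)
qed

text \<open>The right-hand side is the tangent at \<^term>\<open>c\<close> of the concave function on the left.\<close>
lemma diff_mult_ln_le:
  assumes "0 \<le> s" "0 < (c::real)"
  shows "s - s * ln s \<le> c - s * ln c"
proof (cases "s = 0") 
  case False
  hence s: "0 < s" using assms by simp
  have "s * ln (c / s) \<le> s * (c / s - 1)"
    using s assms by (intro mult_left_mono ln_le_minus_one) auto
  thus ?thesis using s assms by (simp add: ln_div algebra_simps)
qed (use assms in auto)

text \<open>For s <= 1/5 the loss in \<open>Re_Li2_polar_inward_ge\<close> is at most 1/5 + (1/5) ln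
  5 + 1/50, by the tangent at 1/5, and ln 5 <= 33/20.\<close>

lemma Re_Li2_polar_inward_bound:
  assumes "- (1 / 5) \<le> t" "t \<le> 0" "\<bar>\<theta>\<bar> \<le> pi"
  shows "pi\<^sup>2 / 6 - pi / 2 * \<bar>\<theta>\<bar> - 11 / 20 \<le> Re (Li2_polar t \<theta>)"
proof -
  define s where "s = - t"
  have s: "0 \<le> s" "s \<le> 1 / 5" using assms by (auto simp: s_def)
  have "ln (5::real) = ln (2 * 2 * (5 / 4))" by simp
  also have "\<dots> = ln 2 + ln 2 + ln (5 / 4)" by (simp only: ln_mult_pos)
  also have "\<dots> \<le> 33 / 20" using ln2_le_25_over_36 ln_le_minus_one[of "5 / 4 :: real"] by simp
  finally have ln5: "ln 5 \<le> (33 / 20 :: real)" .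
  have "s - s * ln s \<le> 1 / 5 + s * ln 5"
    using diff_mult_ln_le[of s "1 / 5"] s by (simp add: ln_div)
  also have "\<dots> \<le> 1 / 5 + 1 / 5 * (33 / 20)"
    using s ln5 by (intro add_mono mult_mono) auto
  finally have "s - s * ln s + s\<^sup>2 / 2 \<le> 11 / 20"
    using power_mono[OF s(2) s(1), of 2] by (simp add: power2_eq_square)
  thus ?thesis
    using Re_Li2_polar_inward_ge[OF s(1), of \<theta>] Re_Li2_polar_0_ge[OF assms(3)] by (simp add: s_def)
qed

text \<open>From at most pi^2/6 in absolute value on the circle, the real part falls by at most t <=
  2/5 and rises by at most t - t ln t <= 4/5, and 4/5 < pi^2/12 because pi^2 > 9.6. Divided by 2
  pi^2, the bound pi^2/4 is the 1/8 in \<open>theta1\<close> and \<open>theta2\<close>.\<close>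

lemma abs_Re_Li2_polar_outward_less:
  assumes "0 \<le> t" "t \<le> 2 / 5" "sin \<theta> \<noteq> 0"
  shows "\<bar>Re (Li2_polar t \<theta>)\<bar> < pi\<^sup>2 / 4"
proof -
  have "\<bar>Re (Li2_polar 0 \<theta>)\<bar> \<le> pi\<^sup>2 / 6"
    using norm_Li2_le[of "exp (Complex 0 \<theta>)"] abs_Re_le_cmod[of "Li2_polar 0 \<theta>"] by simp
  moreover have "Re (Li2_polar 0 \<theta>) \<le> Re (Li2_polar t \<theta>) + t"
    using Re_Li2_polar_radial_ge[of 0 t \<theta>] assms by simp
  moreover have "t - t * ln t \<le> 4 / 5"
  proof -
    have "ln (5 / 2 :: real) = ln 2 + ln (5 / 4)" by (simp flip: ln_mult_pos)
    also have "\<dots> \<le> 1" using ln2_le_25_over_36 ln_le_minus_one[of "5 / 4 :: real"] by simp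
    finally have "t * ln (5 / 2) \<le> 2 / 5 * 1" using assms by (intro mult_mono) auto
    moreover have "ln (2 / 5 :: real) = - ln (5 / 2)" by (simp add: ln_div)
    ultimately show ?thesis using diff_mult_ln_le[of t "2 / 5"] assms by simp
  qed
  moreover have "Re (Li2_polar t \<theta>) \<le> Re (Li2_polar 0 \<theta>) + (t - t * ln t)"
    using assms by (intro Re_Li2_polar_outward_le) auto
  ultimately show ?thesis using pi_squared_bounds assms by (simp add: abs_less_iff)
qed

section \<open>Location of the roots\<close>

lemma ln_rad:
  "ln (rad1 A B) = (if A < 0 then 0 else - kappa / (2 * pi * of_int B))"
  "ln (rad2 A B) = (if A < 0 then kappa / (pi * (2 * of_int B - 1)) else 0)"
  by (simp_all add: rad1_def rad2_def)

lemma kappa_div_le: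
  assumes "(1::int) \<le> B"
  shows "kappa / (2 * pi * of_int B) \<le> 1 / 5" "kappa / (pi * (2 * of_int B - 1)) \<le> 2 / 5"
proof -
  have B: "1 \<le> real_of_int B" using assms by simp
  have "2 * 3 * 1 \<le> 2 * pi * of_int B" "3 * (2 * 1 - 1) \<le> pi * (2 * of_int B - 1)"
    using B pi_gt3 by (intro mult_mono diff_mono; simp)+
  hence "kappa / (2 * pi * of_int B) \<le> (6 / 5) / 6" "kappa / (pi * (2 * of_int B - 1)) \<le> (6 / 5) / 3"
    using kappa_le by (intro frac_le; simp)+
  thus "kappa / (2 * pi * of_int B) \<le> 1 / 5" "kappa / (pi * (2 * of_int B - 1)) \<le> 2 / 5"
    by simp_all
qed

text \<open>Since |rho| <= 1/6 in the disc, 0 < 2 A + rho / 2 < B forces 0 <= 2 A <= B for integers,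
  and the offset rho / 2 is below 1/8.\<close>

lemma phi_root_inside:
  assumes "B \<ge> 1" "z \<noteq> 0" "phi A B z = 0" "Re (Ln z) < 0"
  shows "0 \<le> A \<and> 2 * A \<le> B \<and> z \<in> interior (polar_rect A B)"
proof -
  define t \<theta> where "t = Re (Ln z)" and "\<theta> = Im (Ln z)"
  define \<rho> where "\<rho> = Re (Li2 z) / pi\<^sup>2"
  have B: "1 \<le> real_of_int B" using assms by simp
  have z: "Li2 z = Li2_polar t \<theta>" using assms by (simp add: t_def \<theta>_def del: Re_Ln)
  have range: "t < 0" "0 < \<theta>" "\<theta> < pi"
    using phi_root_location[OF assms(1-3)] assms(4) by (auto simp: t_def \<theta>_def)
  have t: "t = - Im (Li2 z) / (2 * pi * of_int B)"
    and \<theta>: "\<theta> = pi * (2 * of_int A + \<rho> / 2) / of_int B"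
    using assms by (auto simp: phi_eq_0_iff t_def \<theta>_def \<rho>_def)
  have t_gt: "- kappa / (2 * pi * of_int B) < t"
    unfolding t using Im_Li2_polar_lt_kappa[OF range(2,3,1)] B z
    by (intro divide_strict_right_mono) auto
  have "\<bar>Re (Li2 z)\<bar> \<le> pi\<^sup>2 / 6"
    using norm_Li2_le[of "exp (Complex t \<theta>)"] abs_Re_le_cmod[of "Li2 z"] range z by simp
  hence \<rho>: "\<bar>\<rho>\<bar> \<le> 1 / 6" by (simp add: \<rho>_def field_simps)
  have "0 < 2 * of_int A + \<rho> / 2" using range(2) B by (simp add: \<theta> zero_less_divide_iff zero_less_mult_iff)
  hence "real_of_int A > -1" using \<rho> by linarith
  hence A: "0 \<le> A" by linarith
  have "pi * (2 * of_int A + \<rho> / 2) < pi * of_int B" using range(3) B by (simp add: \<theta> pos_divide_less_eq)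
  hence "2 * of_int A + \<rho> / 2 < real_of_int B" by simp
  hence "real_of_int (2 * A) < of_int (B + 1)" using \<rho> by (simp add: abs_le_iff)
  hence AB: "2 * A \<le> B" by linarith
  have mono: "pi * x / of_int B < pi * y / of_int B" if "x < y" for x y
    using that B by (intro divide_strict_right_mono mult_strict_left_mono) auto
  have "theta1 A B < \<theta>"
  proof (cases "A = 0")
    case False
    thus ?thesis using \<rho> unfolding \<theta> theta1_def by (auto intro!: mono simp: abs_le_iff)
  next
    case True
    \<comment> \<open>Otherwise th <= pi/24, so that Re (Li2 z) >= pi^2/6 - pi^2/48 - 11/20, which
      exceeds pi^2/12 because pi^2/16 > 11/20.\<close>
    have "1 / 12 < \<rho>"
    proof (rule ccontr)
      assume "\<not> 1 / 12 < \<rho>"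
      hence le: "\<rho> \<le> 1 / 12" by simp
      have "\<theta> \<le> pi * (1 / 24) / 1"
        unfolding \<theta> using True le B range(2)
        by (intro frac_le mult_left_mono) auto
      hence "pi / 2 * \<bar>\<theta>\<bar> \<le> pi / 2 * (pi / 24)"
        using range by (intro mult_left_mono) auto
      moreover have "pi\<^sup>2 / 6 - pi / 2 * \<bar>\<theta>\<bar> - 11 / 20 \<le> Re (Li2 z)"
        unfolding z using range t_gt kappa_div_le[OF assms(1)]
        by (intro Re_Li2_polar_inward_bound) auto
      moreover have "Re (Li2 z) \<le> pi\<^sup>2 / 12" using le by (simp add: \<rho>_def field_simps)
      moreover have "pi / 2 * (pi / 24) = pi\<^sup>2 / 48" by (simp add: power2_eq_square)
      ultimately show False
        using pi_squared_bounds by linarith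
    qed
    hence "pi * (1 / 24) / of_int B < \<theta>" unfolding \<theta> using True by (intro mono) simp
    thus ?thesis using True by (simp add: theta1_def)
  qed
  moreover have "\<theta> < theta2 A B"
    using range \<rho> unfolding theta2_def by (auto intro!: mono simp: \<theta> abs_le_iff)
  ultimately show ?thesis
    using A AB range t_gt assms
    by (intro conjI in_interior_polar_rect) (simp_all add: ln_rad t_def \<theta>_def)
qed

text \<open>With |rho| < 1/4, integrality leaves - B <= 2 A <= 0; the two end values are excluded by
  the sign of Re (Li2 z).\<close>

lemma phi_root_outside:
  assumes "B \<ge> 1" "z \<noteq> 0" "phi A B z = 0" "0 < Re (Ln z)"
  shows "A < 0 \<and> - B < 2 * A \<and> z \<in> interior (polar_rect A B)"
proof -
  define t \<theta> where "t = Re (Ln z)" and "\<theta> = Im (Ln z)"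
  define \<rho> where "\<rho> = Re (Li2 z) / pi\<^sup>2"
  have B: "1 \<le> real_of_int B" using assms by simp
  have z: "Li2 z = Li2_polar t \<theta>" using assms by (simp add: t_def \<theta>_def del: Re_Ln)
  have range: "0 < t" "- pi < \<theta>" "\<theta> < 0"
    using phi_root_location[OF assms(1-3)] assms(4) by (auto simp: t_def \<theta>_def)
  have sin: "sin \<theta> \<noteq> 0" using sin_gt_zero[of "-\<theta>"] range by auto
  have t: "t = - Im (Li2 z) / (2 * pi * of_int B)"
    and \<theta>: "\<theta> = pi * (2 * of_int A + \<rho> / 2) / of_int B"
    using assms by (auto simp: phi_eq_0_iff t_def \<theta>_def \<rho>_def)
  have "2 * pi * of_int B * t = - Im (Li2 z)" using B by (simp add: t)
  also have "\<dots> < kappa + pi * t" using Im_Li2_polar_gt_kappa[OF range(2,3,1)] z by simp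
  finally have t_lt: "t < kappa / (pi * (2 * of_int B - 1))"
    using B by (simp add: pos_less_divide_eq algebra_simps)
  hence t_le: "t \<le> 2 / 5" using kappa_div_le[OF assms(1)] by linarith
  have "\<bar>Re (Li2 z)\<bar> < pi\<^sup>2 / 4"
    unfolding z using range t_le sin by (intro abs_Re_Li2_polar_outward_less) auto
  hence \<rho>: "\<bar>\<rho>\<bar> < 1 / 4" by (simp add: \<rho>_def field_simps)
  have "2 * of_int A + \<rho> / 2 < 0" using range(3) B by (simp add: \<theta> divide_less_0_iff mult_less_0_iff)
  hence "real_of_int A < 1" using \<rho> by linarith
  hence A: "A \<le> 0" by linarith
  have "- (pi * of_int B) < pi * (2 * of_int A + \<rho> / 2)"
    using range(2) B by (simp add: \<theta> pos_less_divide_eq)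
  hence "pi * - of_int B < pi * (2 * of_int A + \<rho> / 2)" by simp
  hence "- real_of_int B < 2 * of_int A + \<rho> / 2" by (subst (asm) mult_less_cancel_left_pos) auto
  hence "real_of_int (- B - 1) < of_int (2 * A)" using \<rho> by (simp add: abs_less_iff)
  hence AB: "- B \<le> 2 * A" by linarith
  have mono: "pi * x / of_int B < pi * y / of_int B" if "x < y" for x y
    using that B by (intro divide_strict_right_mono mult_strict_left_mono) auto
  have eighth: "\<bar>pi * (\<rho> / 2) / of_int B\<bar> \<le> pi * (1 / 8) / 1"
  proof -
    have "\<bar>pi * (\<rho> / 2) / of_int B\<bar> = pi * (\<bar>\<rho>\<bar> / 2) / of_int B"
      using B by (simp add: abs_mult)
    also have "\<dots> \<le> pi * (1 / 8) / 1"
    proof (rule frac_le)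
      show "pi * (\<bar>\<rho>\<bar> / 2) \<le> pi * (1 / 8)" using \<rho> by (intro mult_left_mono) simp_all
    qed (use B in auto)
    finally show ?thesis .
  qed
  \<comment> \<open>For A = 0 the angle is at most pi/8 in absolute value, so Re (Li2 z) >= pi^2/6 -
    pi^2/16 - 2/5 > 0, and the angle equation makes th positive.\<close>
  have "A \<noteq> 0"
  proof
    assume "A = 0"
    hence \<theta>': "\<theta> = pi * (\<rho> / 2) / of_int B" using \<theta> by simp
    have "pi / 2 * \<bar>\<theta>\<bar> \<le> pi / 2 * (pi / 8)"
      using eighth by (intro mult_left_mono) (auto simp: \<theta>')
    moreover have "pi\<^sup>2 / 6 - pi / 2 * \<bar>\<theta>\<bar> \<le> Re (Li2_polar 0 \<theta>)"
      using range by (intro Re_Li2_polar_0_ge) auto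
    moreover have "Re (Li2_polar 0 \<theta>) + 0 \<le> Re (Li2 z) + t"
      unfolding z using range t_le sin by (intro Re_Li2_polar_radial_ge) auto
    moreover have "pi / 2 * (pi / 8) = pi\<^sup>2 / 16" by (simp add: power2_eq_square)
    ultimately have "0 < Re (Li2 z)" using pi_squared_bounds t_le by linarith
    hence "0 < \<theta>" unfolding \<theta>' \<rho>_def using B by simp
    thus False using range by simp
  qed
  \<comment> \<open>For 2 A = - B the angle is within pi/8 of - pi, so Re (Li2 z) <= - 3/4 + pi^2/16
    < 0, and the angle equation pushes th below - pi.\<close>
  moreover have "2 * A \<noteq> - B"
  proof
    assume "2 * A = - B"
    hence "2 * real_of_int A = - of_int B" by linarith
    hence \<theta>': "\<theta> = - pi + pi * (\<rho> / 2) / of_int B" unfolding \<theta> using B by (simp add: field_simps)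
    have le: "pi - \<bar>\<theta>\<bar> \<le> pi / 8" using eighth range unfolding \<theta>' by linarith
    have "cos (- \<theta>) \<le> cos (pi / 2)"
      using le range by (intro cos_monotone_0_pi_le) auto
    hence "Re (Li2 z) \<le> Re (Li2_polar 0 \<theta>)"
      unfolding z using range sin by (intro Re_Li2_polar_outward_antimono) auto
    also have "\<dots> \<le> - 3 / 4 + pi / 2 * (pi - \<bar>\<theta>\<bar>)"
      using range by (intro Re_Li2_polar_0_le) auto
    also have "\<dots> \<le> - 3 / 4 + pi / 2 * (pi / 8)"
      using le by (intro add_left_mono mult_left_mono) auto
    also have "\<dots> < 0" using pi_squared_bounds by (simp add: power2_eq_square)
    finally have "\<theta> < - pi" unfolding \<theta>' \<rho>_def using B by (simp add: divide_neg_pos mult_pos_neg)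
    thus False using range by simp
  qed
  moreover have "theta1 A B < \<theta>" "\<theta> < theta2 A B"
    using \<rho> A B \<open>A \<noteq> 0\<close> unfolding \<theta> theta1_def theta2_def by (auto intro!: mono simp: abs_less_iff)
  ultimately show ?thesis
    using A AB range t_lt assms pi_gt_zero
    by (intro conjI in_interior_polar_rect) (simp_all add: ln_rad t_def \<theta>_def)
qed

section \<open>Uniqueness\<close>

lemma phi_root_unique:
  assumes "B \<ge> 1" "z \<noteq> 0" "phi A B z = 0" "w \<noteq> 0" "phi A B w = 0"
  shows "z = w"
proof -
  define f where "f = (\<lambda>u. Li2 (exp u) + 4 * of_real pi ^ 2 * of_int A + 2 * of_real pi * \<i> * of_int B * u)"
  have phi: "phi A B u = f (Ln u)" if "u \<noteq> 0" for u
    using that by (simp add: f_def phi_def)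
  have inj: "inj_on f S" if S: "convex S" "\<And>u. u \<in> S \<Longrightarrow> sin (Im u) \<noteq> 0" for S
  proof (rule Im_pos_derivative_imp_inj_on[OF S(1)])
    fix u assume "u \<in> S"
    hence cut: "exp u \<in> cut_plane"
      using exp_Complex_in_cut_plane[of "Re u" "Im u"] S(2)[of u] by simp
    show "(f has_field_derivative - Ln (1 - exp u) + 2 * of_real pi * \<i> * of_int B) (at u)"
      unfolding f_def
      by (auto intro!: derivative_eq_intros has_field_derivative_Li2_exp[OF cut])
    have "Im (Ln (1 - exp u)) < pi * 1"
      unfolding mult_1_right by (intro Im_Ln_less_pi one_minus_notin_nonpos_Reals cut)
    moreover have "pi * 1 \<le> pi * (2 * of_int B)"
      using assms by (intro mult_left_mono) auto
    ultimately have "Im (Ln (1 - exp u)) < pi * (2 * of_int B)"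
      by (rule less_le_trans)
    thus "0 < Im (- Ln (1 - exp u) + 2 * of_real pi * \<i> * of_int B)"
      by (simp add: mult_ac)
  qed
  have "f (Ln z) = f (Ln w)" using assms phi by simp
  have conv: "convex ({u. a < Im u} \<inter> {u. Im u < b})" for a b
    by (intro convex_Int convex_halfspace_Im_gt convex_halfspace_Im_lt)
  \<comment> \<open>The sign of A puts the logarithms of all roots into one of the strips - pi < Im
    < 0 and 0 < Im < pi. Each is convex, and \<open>exp\<close> maps it off the real axis.\<close>
  have "Ln z = Ln w"
  proof (cases "A < 0")
    case True
    have "Ln u \<in> {u. - pi < Im u} \<inter> {u. Im u < 0}" if "u \<noteq> 0" "phi A B u = 0" for u
      using phi_root_location[OF assms(1) that] phi_root_inside[OF assms(1) that] True by auto
    moreover have "inj_on f ({u. - pi < Im u} \<inter> {u. Im u < 0})"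
      using sin_gt_zero[of "- Im u" for u] by (intro inj conv) fastforce
    ultimately show ?thesis using \<open>f (Ln z) = f (Ln w)\<close> assms by (auto dest: inj_onD)
  next
    case False
    have "Ln u \<in> {u. 0 < Im u} \<inter> {u. Im u < pi}" if "u \<noteq> 0" "phi A B u = 0" for u
      using phi_root_location[OF assms(1) that] phi_root_outside[OF assms(1) that] False by auto
    moreover have "inj_on f ({u. 0 < Im u} \<inter> {u. Im u < pi})"
      using sin_gt_zero by (intro inj conv) fastforce
    ultimately show ?thesis using \<open>f (Ln z) = f (Ln w)\<close> assms by (auto dest: inj_onD)
  qed
  thus ?thesis using assms by (metis exp_Ln)
qed

section \<open>Existence by Brouwer's theorem\<close>

lemma phi_root_exists_in_box:
  assumes "B \<ge> 1" "a \<le> b" "c \<le> d" "- pi < c" "d \<le> pi"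
    and cont: "continuous_on (cbox (Complex a c) (Complex b d)) (\<lambda>w. Li2 (exp w))"
    and t: "\<And>t \<theta>. a \<le> t \<Longrightarrow> t \<le> b \<Longrightarrow> c \<le> \<theta> \<Longrightarrow> \<theta> \<le> d \<Longrightarrow>
              - Im (Li2_polar t \<theta>) / (2 * pi * of_int B) \<in> {a..b}"
    and \<theta>: "\<And>t \<theta>. a \<le> t \<Longrightarrow> t \<le> b \<Longrightarrow> c \<le> \<theta> \<Longrightarrow> \<theta> \<le> d \<Longrightarrow>
              pi * (2 * of_int A + Re (Li2_polar t \<theta>) / (2 * pi\<^sup>2)) / of_int B \<in> {c..d}"
  shows "\<exists>z. z \<noteq> 0 \<and> phi A B z = 0"
proof -
  define f where "f = (\<lambda>w. Complex (- Im (Li2 (exp w)) / (2 * pi * of_int B))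
                             (pi * (2 * of_int A + Re (Li2 (exp w)) / (2 * pi\<^sup>2)) / of_int B))"
  have box: "w \<in> cbox (Complex a c) (Complex b d) \<longleftrightarrow>
               a \<le> Re w \<and> Re w \<le> b \<and> c \<le> Im w \<and> Im w \<le> d" for w
    by (auto simp: in_cbox_complex_iff)
  obtain w where w: "w \<in> cbox (Complex a c) (Complex b d)" "f w = w"
  proof (rule brouwer)
    show "continuous_on (cbox (Complex a c) (Complex b d)) f"
      unfolding f_def using assms(1) by (intro continuous_on_Complex continuous_intros cont) auto
    show "f \<in> cbox (Complex a c) (Complex b d) \<rightarrow> cbox (Complex a c) (Complex b d)"
      using t[of "Re w" "Im w" for w] \<theta>[of "Re w" "Im w" for w] by (auto simp: box f_def)
    show "cbox (Complex a c) (Complex b d) \<noteq> {}"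
      using box[of "Complex a c"] assms by auto
  qed (auto simp: compact_cbox convex_box)
  \<comment> \<open>The box lies in - pi < Im <= pi, the range of \<open>Ln\<close>, so a fixed
    point is the principal logarithm of a root.\<close>
  have "Ln (exp w) = w"
    using w assms by (intro Ln_exp) (auto simp: box)
  hence "phi A B (exp w) = 0"
    using arg_cong[OF w(2), of Re] arg_cong[OF w(2), of Im]
    by (subst phi_eq_0_iff[OF assms(1)]) (simp add: f_def)
  thus ?thesis by (intro exI[of _ "exp w"]) auto
qed

lemma phi_root_exists_nonneg:
  assumes "B \<ge> 1" "0 \<le> A" "2 * A \<le> B"
  shows "\<exists>z. z \<noteq> 0 \<and> phi A B z = 0"
proof -
  have B: "1 \<le> real_of_int B" using assms by simp
  define T where "T = kappa / (2 * pi * of_int B)"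
  have T: "0 \<le> T" "T \<le> 1 / 5"
    using kappa_pos kappa_div_le[OF assms(1)] B by (auto simp: T_def)
  \<comment> \<open>1/12 is half the bound 1/6 on |rho|. The box is cut off at angle 0 for A = 0,
    below which \<open>Im Li2\<close> changes sign, and at angle pi for 2 A = B, where the principal
    strip ends; staying inside then requires a sign of rho.\<close>
  define c d where "c = (if A = 0 then 0 else 2 * real_of_int A - 1 / 12)"
    and "d = (if 2 * A = B then real_of_int B else 2 * real_of_int A + 1 / 12)"
  have "0 < A \<Longrightarrow> 1 \<le> real_of_int A" "2 * A < B \<Longrightarrow> real_of_int (2 * A + 1) \<le> of_int B"
    "2 * A = B \<Longrightarrow> 2 * real_of_int A = of_int B"
    by linarith+
  hence cd: "0 \<le> c" "c \<le> d" "d \<le> of_int B"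
    using assms B by (auto simp: c_def d_def)
  have mono: "pi * x / of_int B \<le> pi * y / of_int B" if "x \<le> y" for x y
    using that B by (intro divide_right_mono mult_left_mono) auto
  have range: "0 \<le> \<theta> \<and> \<theta> \<le> pi" if "pi * c / of_int B \<le> \<theta>" "\<theta> \<le> pi * d / of_int B" for \<theta>
    using mono[OF cd(1)] mono[OF cd(3)] that B by simp
  show ?thesis
  proof (rule phi_root_exists_in_box[OF assms(1), of "- T" 0 "pi * c / of_int B" "pi * d / of_int B"])
    show "continuous_on (cbox (Complex (- T) (pi * c / of_int B)) (Complex 0 (pi * d / of_int B)))
            (\<lambda>w. Li2 (exp w))"
      by (rule continuous_on_Li2_exp) (auto simp: in_cbox_complex_iff)
    show "- pi < pi * c / of_int B"
      by (rule less_le_trans[of _ 0]) (use mono[OF cd(1)] in auto)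
    show "pi * d / of_int B \<le> pi" using mono[OF cd(3)] B by simp
  next
    fix t \<theta> assume *: "- T \<le> t" "t \<le> 0" "pi * c / of_int B \<le> \<theta>" "\<theta> \<le> pi * d / of_int B"
    note Im = Im_Li2_polar_nonneg_le_kappa[of \<theta> t]
    show "- Im (Li2_polar t \<theta>) / (2 * pi * of_int B) \<in> {- T..0}"
      using Im range[OF *(3,4)] *(2) B
      by (auto simp: T_def intro!: divide_right_mono)
    define \<rho> where "\<rho> = Re (Li2_polar t \<theta>) / pi\<^sup>2"
    have "\<bar>Re (Li2_polar t \<theta>)\<bar> \<le> pi\<^sup>2 / 6"
      using norm_Li2_le[of "exp (Complex t \<theta>)"] abs_Re_le_cmod[of "Li2_polar t \<theta>"] *(2) by simp
    hence \<rho>: "\<bar>\<rho>\<bar> \<le> 1 / 6" by (simp add: \<rho>_def field_simps)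
    \<comment> \<open>Here th <= pi/12, so the real part is at least pi^2/6 - pi^2/24 - 11/20 >
      0.\<close>
    have "0 \<le> \<rho>" if "A = 0"
    proof -
      have "\<theta> \<le> pi * (1 / 12) / of_int B" using *(4) that assms by (simp add: d_def)
      also have "\<dots> \<le> pi * (1 / 12) / 1" using B by (intro divide_left_mono) auto
      finally have "pi / 2 * \<bar>\<theta>\<bar> \<le> pi / 2 * (pi / 12)"
        using range[OF *(3,4)] by (intro mult_left_mono) auto
      moreover have "pi\<^sup>2 / 6 - pi / 2 * \<bar>\<theta>\<bar> - 11 / 20 \<le> Re (Li2_polar t \<theta>)"
        using * T range[OF *(3,4)] by (intro Re_Li2_polar_inward_bound) auto
      moreover have "pi / 2 * (pi / 12) = pi\<^sup>2 / 24" by (simp add: power2_eq_square)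
      ultimately have "0 \<le> Re (Li2_polar t \<theta>)"
        using pi_squared_bounds by linarith
      thus ?thesis by (simp add: \<rho>_def)
    qed
    \<comment> \<open>Near the negative axis the real part is at most - 3/4 + pi^2/24 on the circle,
      and moving inward adds at most 1/5.\<close>
    moreover have "\<rho> \<le> 0" if AB: "2 * A = B"
    proof -
      have AB': "2 * real_of_int A = of_int B" using AB by linarith
      have "pi * (of_int B - 1 / 12) / of_int B \<le> \<theta>" using *(3) AB AB' assms by (simp add: c_def split: if_splits)
      moreover have "pi * (of_int B - 1 / 12) / of_int B = pi - pi * (1 / 12) / of_int B"
        using B by (simp add: field_simps)
      moreover have "pi * (1 / 12) / of_int B \<le> pi * (1 / 12) / 1"
        using B by (intro divide_left_mono) auto
      ultimately have le: "pi - \<bar>\<theta>\<bar> \<le> pi / 12" using range[OF *(3,4)] by simp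
      have "Re (Li2_polar t \<theta>) + t \<le> Re (Li2_polar 0 \<theta>) + 0"
        using * by (intro Re_Li2_polar_radial_ge) auto
      also have "Re (Li2_polar 0 \<theta>) \<le> - 3 / 4 + pi / 2 * (pi - \<bar>\<theta>\<bar>)"
        using range[OF *(3,4)] by (intro Re_Li2_polar_0_le) auto
      also have "\<dots> \<le> - 3 / 4 + pi / 2 * (pi / 12)"
        using le by (intro add_left_mono mult_left_mono) auto
      finally have "Re (Li2_polar t \<theta>) \<le> 0"
        using pi_squared_bounds * T by (simp add: power2_eq_square)
      thus ?thesis by (simp add: \<rho>_def divide_nonpos_pos)
    qed
    ultimately have "c \<le> 2 * of_int A + \<rho> / 2" "2 * of_int A + \<rho> / 2 \<le> d"
      using \<rho> by (auto simp: c_def d_def abs_le_iff)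
    moreover have "\<rho> / 2 = Re (Li2_polar t \<theta>) / (2 * pi\<^sup>2)" by (simp add: \<rho>_def)
    ultimately have "c \<le> 2 * of_int A + Re (Li2_polar t \<theta>) / (2 * pi\<^sup>2)"
      "2 * of_int A + Re (Li2_polar t \<theta>) / (2 * pi\<^sup>2) \<le> d"
      by simp_all
    from mono[OF this(1)] mono[OF this(2)]
    show "pi * (2 * of_int A + Re (Li2_polar t \<theta>) / (2 * pi\<^sup>2)) / of_int B
             \<in> {pi * c / of_int B..pi * d / of_int B}"
      by simp
  qed (use T mono[OF cd(2)] in auto)
qed

lemma phi_root_exists_neg:
  assumes "B \<ge> 1" "A < 0" "- B < 2 * A"
  shows "\<exists>z. z \<noteq> 0 \<and> phi A B z = 0"
proof -
  have B: "1 \<le> real_of_int B" using assms by simp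
  define T where "T = kappa / (pi * (2 * of_int B - 1))"
  have T: "0 \<le> T" "T \<le> 2 / 5"
    using kappa_pos kappa_div_le[OF assms(1)] B by (auto simp: T_def)
  \<comment> \<open>\<open>T\<close> is the fixed point of x |-> (kappa + pi x) / (2 pi B), so the
    bound on the new radial coordinate for 0 <= t <= \<open>T\<close> is \<open>T\<close>
    again.\<close>
  have T_eq: "(kappa + pi * T) / (2 * pi * of_int B) = T"
    using B by (simp add: T_def field_simps)
  \<comment> \<open>As 2 A lies between - B + 1 and - 2, the margin 1/8 keeps the box strictly
    between the angles - pi and 0, away from the cut.\<close>
  define c d where "c = 2 * real_of_int A - 1 / 8" and "d = 2 * real_of_int A + 1 / 8"
  have "real_of_int A \<le> -1" "- of_int B + 1 \<le> 2 * real_of_int A"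
    using assms by linarith+
  hence cd: "- of_int B < c" "c \<le> d" "d < 0"
    by (auto simp: c_def d_def)
  have mono: "pi * x / of_int B \<le> pi * y / of_int B" if "x \<le> y" for x y
    using that B by (intro divide_right_mono mult_left_mono) auto
  have smono: "pi * x / of_int B < pi * y / of_int B" if "x < y" for x y
    using that B by (intro divide_strict_right_mono mult_strict_left_mono) auto
  have range: "- pi < \<theta> \<and> \<theta> < 0" if "pi * c / of_int B \<le> \<theta>" "\<theta> \<le> pi * d / of_int B" for \<theta>
    using smono[OF cd(1)] smono[OF cd(3)] that B by simp
  have sin: "sin \<theta> < 0" if "- pi < \<theta> \<and> \<theta> < 0" for \<theta>
    using sin_gt_zero[of "-\<theta>"] that by simp
  show ?thesis
  proof (rule phi_root_exists_in_box[OF assms(1), of 0 T "pi * c / of_int B" "pi * d / of_int B"])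
    show "continuous_on (cbox (Complex 0 (pi * c / of_int B)) (Complex T (pi * d / of_int B)))
            (\<lambda>w. Li2 (exp w))"
    proof (intro continuous_at_imp_continuous_on ballI)
      fix w assume "w \<in> cbox (Complex 0 (pi * c / of_int B)) (Complex T (pi * d / of_int B))"
      hence "exp w \<in> cut_plane"
        using sin[OF range, of "Im w"] exp_Complex_in_cut_plane[of "Re w" "Im w"]
        by (auto simp: in_cbox_complex_iff)
      thus "isCont (\<lambda>w. Li2 (exp w)) w"
        by (rule DERIV_isCont[OF has_field_derivative_Li2_exp])
    qed
    show "- pi < pi * c / of_int B" using smono[OF cd(1)] B by simp
    show "pi * d / of_int B \<le> pi"
      by (rule order_trans[of _ 0]) (use smono[OF cd(3)] in auto)
  next
    fix t \<theta> assume *: "0 \<le> t" "t \<le> T" "pi * c / of_int B \<le> \<theta>" "\<theta> \<le> pi * d / of_int B"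
    note \<theta> = range[OF *(3,4)]
    have "Im (Li2_polar t \<theta>) \<le> 0"
      using Im_Li2_neg[of "exp (Complex t \<theta>)"] sin[OF \<theta>] by (simp add: Im_exp mult_pos_neg)
    moreover have "- Im (Li2_polar t \<theta>) \<le> kappa + pi * t"
      using Im_Li2_polar_gt_kappa[of \<theta> t] Im_Li2_polar_0_le_kappa[of "- \<theta>"] \<theta> *(1)
      by (cases "t = 0") (auto simp: Li2_polar_uminus)
    moreover have "pi * t \<le> pi * T" using *(2) by (intro mult_left_mono) auto
    ultimately have Im: "0 \<le> - Im (Li2_polar t \<theta>)" "- Im (Li2_polar t \<theta>) \<le> kappa + pi * T"
      by linarith+
    have "0 \<le> 2 * pi * real_of_int B" using B by simp
    from divide_right_mono[OF Im(2) this] divide_nonneg_nonneg[OF Im(1) this]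
    have "- Im (Li2_polar t \<theta>) / (2 * pi * of_int B) \<le> (kappa + pi * T) / (2 * pi * of_int B)"
      "0 \<le> - Im (Li2_polar t \<theta>) / (2 * pi * of_int B)"
      by simp_all
    thus "- Im (Li2_polar t \<theta>) / (2 * pi * of_int B) \<in> {0..T}"
      by (simp only: T_eq atLeastAtMost_iff)
    define \<rho> where "\<rho> = Re (Li2_polar t \<theta>) / pi\<^sup>2"
    have "\<bar>Re (Li2_polar t \<theta>)\<bar> < pi\<^sup>2 / 4"
      using sin[OF \<theta>] * T by (intro abs_Re_Li2_polar_outward_less) auto
    hence "\<bar>\<rho>\<bar> < 1 / 4" by (simp add: \<rho>_def field_simps)
    hence "c \<le> 2 * of_int A + \<rho> / 2" "2 * of_int A + \<rho> / 2 \<le> d"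
      by (auto simp: c_def d_def abs_less_iff)
    moreover have "\<rho> / 2 = Re (Li2_polar t \<theta>) / (2 * pi\<^sup>2)" by (simp add: \<rho>_def)
    ultimately have "c \<le> 2 * of_int A + Re (Li2_polar t \<theta>) / (2 * pi\<^sup>2)"
      "2 * of_int A + Re (Li2_polar t \<theta>) / (2 * pi\<^sup>2) \<le> d"
      by simp_all
    from mono[OF this(1)] mono[OF this(2)]
    show "pi * (2 * of_int A + Re (Li2_polar t \<theta>) / (2 * pi\<^sup>2)) / of_int B
             \<in> {pi * c / of_int B..pi * d / of_int B}"
      by simp
  qed (use T mono[OF cd(2)] in auto)
qed

theorem theorem5p6:
  fixes A B :: int
  assumes "B \<ge> 1"
  shows "((\<exists>z. z \<noteq> 0 \<and> phi A B z = 0) \<longleftrightarrow>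
            - (real_of_int B / 2) < real_of_int A \<and> real_of_int A \<le> real_of_int B / 2) \<and>
         (- (real_of_int B / 2) < real_of_int A \<and> real_of_int A \<le> real_of_int B / 2 \<longrightarrow>
            (\<exists>!z. z \<noteq> 0 \<and> phi A B z = 0) \<and>
            (\<forall>z. z \<noteq> 0 \<and> phi A B z = 0 \<longrightarrow> z \<in> interior (polar_rect A B)))"
proof -
  have range: "- (real_of_int B / 2) < real_of_int A \<and> real_of_int A \<le> real_of_int B / 2 \<longleftrightarrow>
                 - B < 2 * A \<and> 2 * A \<le> B"
    by linarith
  have root: "- B < 2 * A \<and> 2 * A \<le> B \<and> z \<in> interior (polar_rect A B)"
    if z: "z \<noteq> 0" "phi A B z = 0" for z
    using phi_root_location[OF assms z] phi_root_inside[OF assms z] phi_root_outside[OF assms z] assms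
    by auto
  have ex: "\<exists>z. z \<noteq> 0 \<and> phi A B z = 0" if "- B < 2 * A \<and> 2 * A \<le> B"
    using that phi_root_exists_nonneg[OF assms] phi_root_exists_neg[OF assms] by (cases "0 \<le> A") auto
  show ?thesis
    unfolding range using root ex phi_root_unique[OF assms] by blast
qed

end
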